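(* For each $z\in\mathbb Z[\tau]$ there is a unique $w$-NAF $\xi\in\mathcal N^{\mathrm{fin}.0}$ with $\mathrm{value}(\xi)=z$; thus $\mathcal D$ is a width-$w$ non-adjacent digit set. Moreover, the following algorithm terminates for every input $z\in\mathbb Z[\tau]$ and outputs this $w$-NAF: set $\ell\leftarrow0$, $y\leftarrow z$; while $y\ne0$: if $\tau\mid y$ set $\xi_\ell\leftarrow0$, otherwise let $\xi_\ell$ be the element of $\mathcal D$ with $\xi_\ell\equiv y\pmod{\tau^w}$; then set $y\leftarrow(y-\xi_\ell)/\tau$ and $\ell\leftarrow\ell+1$; finally output $\xi_{\ell-1}\dots\xi_1\xi_0$.
   Context: Let $p,q\in\mathbb Z$ with $4q-p^2>0$ and let $\tau$ be a root of $X^2-pX+q$, with $|\tau|>1$; let $w\ge2$ be an integer. Voronoi cell $V=\{z\in\mathbb C:|z|\le|z-y|\ \forall y\in\mathbb Z[\tau]\}$ (a convex polygon). Label its vertices counter-clockwise $v_0,\dots,v_{m-1}$ starting with the vertex of real part $1/2$ and positive imaginary part, indices mod $m$, $v_{k+1/2}$ the midpoint of $v_kv_{k+1}$. The restricted Voronoi cell $\widetilde V$ consists of the interior of $V$, the segments from $v_{k+1/2}$ (excluded) to $v_{k+1}$ (excluded) for all $k$, the points $v_{k+1/2}$ for $0\le k\le\lfloor m/2\rfloor-1$ and the points $v_k$ for $1\le k\le\lfloor m/3\rfloor$; the translates $u+\widetilde V$, $u\in\mathbb Z[\tau]$, partition $\mathbb C$. Digit set $\mathcal D$: $0$ together with,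 for each residue class modulo $\tau^w$ not divisible by $\tau$, its unique element in $\tau^w\widetilde V$. A $w$-NAF is a sequence $(\xi_j)_{j\in\mathbb Z}\in\mathcal D^{\mathbb Z}$ in which each block of $w$ consecutive digits contains at most one nonzero digit; $\mathcal N^{\mathrm{fin}.0}$ is the set of $w$-NAFs with $\xi_j=0$ for all $j<0$ and all but finitely many $j$; $\mathrm{value}(\xi)=\sum_j\xi_j\tau^j$. A digit set is a width-$w$ non-adjacent digit set if every element of $\mathbb Z[\tau]$ has a unique $w$-NAF in $\mathcal N^{\mathrm{fin}.0}$. *)

theory Defs
  imports
    "HOL-Analysis.Analysis"
    "HOL-Computational_Algebra.Polynomial"
    "HOL-Library.While_Combinator"
begin

definition Z_adjoin :: "complex \<Rightarrow> complex set" where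
  "Z_adjoin \<tau> = range (\<lambda>f :: int poly. poly (map_poly of_int f) \<tau>)"

text \<open>Divisibility inside \<open>\<int>[\<tau>]\<close>; the class operation \<open>dvd\<close> on type
  \<^typ>\<open>complex\<close> is divisibility in a field and hence of no use here.\<close>

definition Z_dvd :: "complex \<Rightarrow> complex \<Rightarrow> complex \<Rightarrow> bool" where
  "Z_dvd \<tau> a b \<longleftrightarrow> (\<exists>c \<in> Z_adjoin \<tau>. b = a * c)"

definition Z_cong :: "complex \<Rightarrow> nat \<Rightarrow> complex \<Rightarrow> complex \<Rightarrow> bool" where
  "Z_cong \<tau> w a b \<longleftrightarrow> Z_dvd \<tau> (\<tau> ^ w) (a - b)"

definition voronoi :: "complex \<Rightarrow> complex set" where
  "voronoi \<tau> = {z. \<forall>y \<in> Z_adjoin \<tau>. cmod z \<le> cmod (z - y)}"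

definition voronoi_vertices :: "complex \<Rightarrow> complex set" where
  "voronoi_vertices \<tau> = {v. v extreme_point_of voronoi \<tau>}"

definition start_vertex :: "complex \<Rightarrow> complex" where
  "start_vertex \<tau> = (THE v. v \<in> voronoi_vertices \<tau> \<and> Re v = 1 / 2 \<and> Im v > 0)"

text \<open>The Voronoi cell is convex and has the origin in its interior, so counter-clockwise
  order of its vertices is the order of their angles (in \<open>[0, 2\<pi>)\<close>) measured from the
  start vertex.\<close>

definition vertex_list :: "complex \<Rightarrow> complex list" where
  "vertex_list \<tau> =
     sorted_key_list_of_set (\<lambda>v. Arg2pi (v / start_vertex \<tau>)) (voronoi_vertices \<tau>)"

definition num_vertices :: "complex \<Rightarrow> nat" where
  "num_vertices \<tau> = card (voronoi_vertices \<tau>)"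

definition vertex :: "complex \<Rightarrow> nat \<Rightarrow> complex" where
  "vertex \<tau> k = vertex_list \<tau> ! (k mod num_vertices \<tau>)"

definition edge_midpoint :: "complex \<Rightarrow> nat \<Rightarrow> complex" where
  "edge_midpoint \<tau> k = midpoint (vertex \<tau> k) (vertex \<tau> (k + 1))"

definition restricted_voronoi :: "complex \<Rightarrow> complex set" where
  "restricted_voronoi \<tau> =
     interior (voronoi \<tau>)
     \<union> (\<Union>k < num_vertices \<tau>. open_segment (edge_midpoint \<tau> k) (vertex \<tau> (k + 1)))
     \<union> edge_midpoint \<tau> ` {k. k < num_vertices \<tau> div 2}
     \<union> vertex \<tau> ` {1..num_vertices \<tau> div 3}"

definition residue_class :: "complex \<Rightarrow> nat \<Rightarrow> complex \<Rightarrow> complex set" where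
  "residue_class \<tau> w x = {y \<in> Z_adjoin \<tau>. Z_cong \<tau> w y x}"

definition digits :: "complex \<Rightarrow> nat \<Rightarrow> complex set" where
  "digits \<tau> w =
     insert 0 {the_elem (residue_class \<tau> w x \<inter> (\<lambda>z. \<tau> ^ w * z) ` restricted_voronoi \<tau>) | x.
       x \<in> Z_adjoin \<tau> \<and> \<not> Z_dvd \<tau> \<tau> x}"

definition is_wNAF :: "nat \<Rightarrow> complex set \<Rightarrow> (int \<Rightarrow> complex) \<Rightarrow> bool" where
  "is_wNAF w D \<xi> \<longleftrightarrow>
     (\<forall>j. \<xi> j \<in> D) \<and> (\<forall>k. card {j \<in> {k..<k + int w}. \<xi> j \<noteq> 0} \<le> 1)"

definition wNAF_fin0 :: "nat \<Rightarrow> complex set \<Rightarrow> (int \<Rightarrow> complex) set" where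
  "wNAF_fin0 w D =
     {\<xi>. is_wNAF w D \<xi> \<and> (\<forall>j < 0. \<xi> j = 0) \<and> finite {j. \<xi> j \<noteq> 0}}"

definition naf_value :: "complex \<Rightarrow> (int \<Rightarrow> complex) \<Rightarrow> complex" where
  "naf_value \<tau> \<xi> = (\<Sum>\<^sub>\<infinity>j. \<xi> j * \<tau> powi j)"

definition wNADS :: "complex \<Rightarrow> nat \<Rightarrow> complex set \<Rightarrow> bool" where
  "wNADS \<tau> w D \<longleftrightarrow>
     (\<forall>z \<in> Z_adjoin \<tau>. \<exists>!\<xi>. \<xi> \<in> wNAF_fin0 w D \<and> naf_value \<tau> \<xi> = z)"

definition next_digit :: "complex \<Rightarrow> nat \<Rightarrow> complex \<Rightarrow> complex" where
  "next_digit \<tau> w y =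
     (if Z_dvd \<tau> \<tau> y then 0 else (THE d. d \<in> digits \<tau> w \<and> Z_cong \<tau> w d y))"

text \<open>The state of the loop is \<open>(\<xi>, l, y)\<close>; only the entries \<open>\<xi> 0, \<dots>, \<xi> (l - 1)\<close> have been
  assigned. The result is \<^const>\<open>None\<close> if the loop does not terminate, and otherwise the
  word \<open>\<xi> (l - 1) \<dots> \<xi> 0\<close>, most significant digit first.\<close>

definition naf_algorithm :: "complex \<Rightarrow> nat \<Rightarrow> complex \<Rightarrow> complex list option" where
  "naf_algorithm \<tau> w z =
     map_option (\<lambda>(\<xi>, l, y). rev (map \<xi> [0..<l]))
       (while_option
         (\<lambda>(\<xi>, l, y). y \<noteq> 0)
         (\<lambda>(\<xi>, l, y). (\<xi>(l := next_digit \<tau> w y), l + 1, (y - next_digit \<tau> w y) / \<tau>))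
         ((\<lambda>_. undefined) :: nat \<Rightarrow> complex, 0 :: nat, z))"

definition word_seq :: "complex list \<Rightarrow> int \<Rightarrow> complex" where
  "word_seq ds j = (if 0 \<le> j \<and> j < int (length ds) then rev ds ! nat j else 0)"

end

theory Submission
  imports Defs
begin

text \<open>The cell of a lattice is a polygon symmetric about \<open>0\<close>, and each of its edges lies on the
  bisector of \<open>0\<close> and a lattice point, a neighbour. Subtracting the neighbour maps the edge to the
  opposite one, its first half to the second half of the opposite edge and vice versa, so translates
  of the restricted cell tile the plane as soon as the selected vertices represent each class of
  vertices once. The ring \<open>\<int>[\<tau>]\<close> is generated by \<open>1\<close> and some \<open>\<omega>\<close> with \<open>Re \<omega> \<in> {0, 1/2}\<close>, and its
  cell is a rectangle or a hexagon.

  If \<open>y\<close> is not divisible by \<open>\<tau>\<close> and \<open>d\<close> is its digit, then \<open>c = (y - d) / \<tau> ^ w\<close> is a lattice point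
  nearest to \<open>y / \<tau> ^ w\<close>. Comparing it with the lattice point \<open>0\<close> gives
  \<open>cmod c \<le> 2 * cmod y / cmod \<tau> ^ w\<close>, so the absolute value strictly decreases unless \<open>q = w = 2\<close> and
  \<open>c = 2 * y / \<tau>\<^sup>2\<close>; the latter cannot happen forever, because the restricted cell does not contain both
  halves \<open>\<plusminus> c / 2\<close> of a lattice point. Hence the algorithm terminates. Uniqueness holds since
  the lowest digit of a w-NAF is determined by the residue class of its value.\<close>

section \<open>The ring \<open>\<int>[\<tau>]\<close>\<close>

lemma Z_adjoinI: "poly (map_poly of_int f) \<tau> \<in> Z_adjoin \<tau>"
  by (simp add: Z_adjoin_def)

lemma of_int_in_Z_adjoin [simp, intro]: "of_int a \<in> Z_adjoin \<tau>"
  using Z_adjoinI[of "[:a:]" \<tau>] by (simp add: map_poly_pCons)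

lemma Z_adjoin_0 [simp, intro]: "0 \<in> Z_adjoin \<tau>"
  using of_int_in_Z_adjoin[of 0] by simp

lemma Z_adjoin_self [simp, intro]: "\<tau> \<in> Z_adjoin \<tau>"
  using Z_adjoinI[of "[:0, 1:]" \<tau>] by (simp add: map_poly_pCons)

lemma Z_adjoin_add [intro]:
  assumes "x \<in> Z_adjoin \<tau>" "y \<in> Z_adjoin \<tau>"
  shows "x + y \<in> Z_adjoin \<tau>"
proof -
  have "map_poly of_int (f + g) = map_poly of_int f + (map_poly of_int g :: complex poly)" for f g
    by (simp add: poly_eq_iff coeff_map_poly)
  then have "poly (map_poly of_int f) \<tau> + poly (map_poly of_int g) \<tau> \<in> Z_adjoin \<tau>" for f g
    using Z_adjoinI[of "f + g" \<tau>] by simp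
  then show ?thesis
    using assms by (auto simp: Z_adjoin_def)
qed

lemma Z_adjoin_mult [intro]:
  assumes "x \<in> Z_adjoin \<tau>" "y \<in> Z_adjoin \<tau>"
  shows "x * y \<in> Z_adjoin \<tau>"
proof -
  obtain f where "x = poly (map_poly of_int f) \<tau>"
    using assms(1) by (auto simp: Z_adjoin_def)
  then show ?thesis
  proof (induction f arbitrary: x)
    case (pCons c f)
    obtain g where "y = poly (map_poly of_int g) \<tau>"
      using assms(2) by (auto simp: Z_adjoin_def)
    moreover have "map_poly of_int (smult c g) = smult (of_int c) (map_poly of_int g :: complex poly)"
      by (simp add: map_poly_smult)
    ultimately have "of_int c * y \<in> Z_adjoin \<tau>"
      using Z_adjoinI[of "smult c g" \<tau>] by simp
    moreover obtain h where "poly (map_poly of_int f) \<tau> * y = poly (map_poly of_int h) \<tau>"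
      using pCons.IH by (auto simp: Z_adjoin_def)
    then have "\<tau> * (poly (map_poly of_int f) \<tau> * y) \<in> Z_adjoin \<tau>"
      using Z_adjoinI[of "pCons 0 h" \<tau>] by (simp add: map_poly_pCons)
    ultimately show ?case
      using pCons.prems by (auto simp: map_poly_pCons distrib_right mult.assoc)
  qed simp
qed

lemma Z_adjoin_minus [intro]: "x \<in> Z_adjoin \<tau> \<Longrightarrow> - x \<in> Z_adjoin \<tau>"
  using Z_adjoin_mult[OF of_int_in_Z_adjoin[of "-1"]] by simp

lemma Z_adjoin_diff [intro]: "x \<in> Z_adjoin \<tau> \<Longrightarrow> y \<in> Z_adjoin \<tau> \<Longrightarrow> x - y \<in> Z_adjoin \<tau>"
  using Z_adjoin_add[of x \<tau> "- y"] by auto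

lemma Z_adjoin_power [intro]: "x \<in> Z_adjoin \<tau> \<Longrightarrow> x ^ n \<in> Z_adjoin \<tau>"
  using of_int_in_Z_adjoin[of 1] by (induction n) auto

lemma Z_adjoin_sum [intro]: "(\<And>i. i \<in> I \<Longrightarrow> f i \<in> Z_adjoin \<tau>) \<Longrightarrow> sum f I \<in> Z_adjoin \<tau>"
  by (induction I rule: infinite_finite_induct) auto

lemma Z_dvd_0 [simp]: "Z_dvd \<tau> a 0"
  by (auto simp: Z_dvd_def intro: bexI[of _ 0])

lemma Z_dvd_mult_self: "c \<in> Z_adjoin \<tau> \<Longrightarrow> Z_dvd \<tau> a (a * c)"
  by (auto simp: Z_dvd_def)

lemma Z_dvd_diff:
  assumes "Z_dvd \<tau> a x" "Z_dvd \<tau> a y"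
  shows "Z_dvd \<tau> a (x - y)"
proof -
  obtain c d where "c \<in> Z_adjoin \<tau>" "x = a * c" "d \<in> Z_adjoin \<tau>" "y = a * d"
    using assms by (auto simp: Z_dvd_def)
  then show ?thesis
    using Z_dvd_mult_self[of "c - d" \<tau> a] by (auto simp: right_diff_distrib)
qed

lemma Z_cong_iff: "Z_cong \<tau> n a b \<longleftrightarrow> (\<exists>c\<in>Z_adjoin \<tau>. a = b + \<tau> ^ n * c)"
  by (auto simp: Z_cong_def Z_dvd_def algebra_simps)

lemma Z_cong_refl [simp]: "Z_cong \<tau> n a a"
  by (simp add: Z_cong_def)

lemma Z_cong_imp_dvd_iff:
  assumes "Z_cong \<tau> n a b" "n > 0"
  shows "Z_dvd \<tau> \<tau> a \<longleftrightarrow> Z_dvd \<tau> \<tau> b"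
proof -
  obtain c where c: "c \<in> Z_adjoin \<tau>" "a - b = \<tau> ^ n * c"
    using assms(1) by (auto simp: Z_cong_def Z_dvd_def)
  moreover obtain m where "n = Suc m"
    using assms(2) gr0_implies_Suc by blast
  ultimately have "a - b = \<tau> * (\<tau> ^ m * c)" "\<tau> ^ m * c \<in> Z_adjoin \<tau>"
    by auto
  then have "Z_dvd \<tau> \<tau> (a - b)"
    using Z_dvd_mult_self by metis
  moreover have "a - (a - b) = b" "a - b - (0 - b) = a"
    by simp_all
  ultimately show ?thesis
    using Z_dvd_diff Z_dvd_0 by metis
qed

section \<open>Voronoi cells\<close>

definition bisector :: "'a::real_inner \<Rightarrow> 'a set" where
  "bisector u = {z. norm z = norm (z - u)}"

definition strip :: "'a::real_inner \<Rightarrow> 'a set" where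
  "strip u = {z. 2 * \<bar>z \<bullet> u\<bar> \<le> u \<bullet> u}"

lemma in_bisector_iff: "z \<in> bisector u \<longleftrightarrow> 2 * (z \<bullet> u) = u \<bullet> u"
  by (auto simp: bisector_def norm_eq inner_diff_left inner_diff_right inner_commute)

lemma strip_uminus: "strip (- u) = strip u"
  by (simp add: strip_def)

lemma in_voronoi_iff: "z \<in> voronoi \<tau> \<longleftrightarrow> (\<forall>y\<in>Z_adjoin \<tau>. 2 * (z \<bullet> y) \<le> y \<bullet> y)"
  by (simp add: voronoi_def norm_le inner_diff_left inner_diff_right inner_commute)

lemma in_voronoiD: "z \<in> voronoi \<tau> \<Longrightarrow> y \<in> Z_adjoin \<tau> \<Longrightarrow> 2 * (z \<bullet> y) \<le> y \<bullet> y"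
  by (simp add: in_voronoi_iff)

lemma uminus_in_voronoi: "z \<in> voronoi \<tau> \<Longrightarrow> - z \<in> voronoi \<tau>"
  using in_voronoiD[of z \<tau> "- y" for y] by (auto simp: in_voronoi_iff)

lemma convex_voronoi: "convex (voronoi \<tau>)"
proof -
  have "voronoi \<tau> = (\<Inter>y\<in>Z_adjoin \<tau>. {z. (2 *\<^sub>R y) \<bullet> z \<le> y \<bullet> y})"
    by (auto simp: in_voronoi_iff inner_commute)
  then show ?thesis
    by (simp add: convex_INT convex_halfspace_le del: inner_scaleR_left)
qed

lemma voronoi_diff_iff:
  assumes "z \<in> voronoi \<tau>" "u \<in> Z_adjoin \<tau>"
  shows "z - u \<in> voronoi \<tau> \<longleftrightarrow> z \<in> bisector u"
proof
  assume "z - u \<in> voronoi \<tau>"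
  then have "2 * ((z - u) \<bullet> (- u)) \<le> (- u) \<bullet> (- u)"
    using assms(2) by (intro in_voronoiD) auto
  with in_voronoiD[OF assms] show "z \<in> bisector u"
    by (simp add: in_bisector_iff inner_diff_left)
next
  assume tie: "z \<in> bisector u"
  have "2 * ((z - u) \<bullet> y) \<le> y \<bullet> y" if "y \<in> Z_adjoin \<tau>" for y
  proof -
    have "2 * (z \<bullet> (u + y)) \<le> (u + y) \<bullet> (u + y)"
      using assms that by (intro in_voronoiD) auto
    with tie show ?thesis
      by (simp add: in_bisector_iff inner_diff_left inner_add_left inner_add_right
          inner_commute[of y u])
  qed
  then show "z - u \<in> voronoi \<tau>"
    by (simp add: in_voronoi_iff)
qed

lemma interior_voronoi_unique:
  assumes "z \<in> interior (voronoi \<tau>)" "u \<in> Z_adjoin \<tau>" "z - u \<in> voronoi \<tau>"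
  shows "u = 0"
proof (rule ccontr)
  assume "u \<noteq> 0"
  obtain \<epsilon> where \<epsilon>: "\<epsilon> > 0" "cball z \<epsilon> \<subseteq> voronoi \<tau>"
    using assms(1) by (auto simp: mem_interior_cball)
  define \<delta> where "\<delta> = \<epsilon> / norm u"
  have "z + \<delta> *\<^sub>R u \<in> cball z \<epsilon>"
    using \<epsilon>(1) \<open>u \<noteq> 0\<close> by (simp add: \<delta>_def dist_norm)
  with \<epsilon>(2) have "2 * ((z + \<delta> *\<^sub>R u) \<bullet> u) \<le> u \<bullet> u"
    using assms(2) by (intro in_voronoiD) auto
  moreover have "z \<in> bisector u"
    using assms interior_subset voronoi_diff_iff by blast
  moreover have "\<delta> * (u \<bullet> u) > 0"
    using \<epsilon>(1) \<open>u \<noteq> 0\<close> by (simp add: \<delta>_def)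
  ultimately show False
    by (simp add: in_bisector_iff inner_add_left)
qed

lemma bisector_if_open_segment_meets:
  assumes "a \<in> voronoi \<tau>" "b \<in> voronoi \<tau>" "z \<in> open_segment a b"
    and "u \<in> Z_adjoin \<tau>" "z \<in> bisector u"
  shows "a \<in> bisector u" "b \<in> bisector u"
proof -
  obtain t where t: "0 < t" "t < 1" "z = (1 - t) *\<^sub>R a + t *\<^sub>R b"
    using assms(3) by (auto simp: in_segment)
  define \<alpha> \<beta> where "\<alpha> = u \<bullet> u - 2 * (a \<bullet> u)" and "\<beta> = u \<bullet> u - 2 * (b \<bullet> u)"
  have "(1 - t) * \<alpha> + t * \<beta> = 0"
    using assms(5) by (simp add: in_bisector_iff \<alpha>_def \<beta>_def t(3) inner_add_left algebra_simps)
  moreover have "0 \<le> (1 - t) * \<alpha>" "0 \<le> t * \<beta>"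
    using t in_voronoiD assms by (auto simp: \<alpha>_def \<beta>_def)
  ultimately have "(1 - t) * \<alpha> = 0" "t * \<beta> = 0"
    by linarith+
  then show "a \<in> bisector u" "b \<in> bisector u"
    using t by (simp_all add: in_bisector_iff \<alpha>_def \<beta>_def)
qed

lemma voronoi_remainder:
  assumes "v \<in> voronoi \<tau>" "c \<in> Z_adjoin \<tau>"
  shows "cmod c \<le> 2 * cmod (v + c)" "cmod c = 2 * cmod (v + c) \<Longrightarrow> c = - 2 * v"
proof -
  have nearest: "cmod v \<le> cmod (v + c)"
    using assms Z_adjoin_minus[of c \<tau>] by (force simp: voronoi_def)
  have "cmod c \<le> cmod (v + c) + cmod v"
    using norm_triangle_ineq4[of "v + c" v] by simp
  with nearest show "cmod c \<le> 2 * cmod (v + c)" by simp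
  assume tight: "cmod c = 2 * cmod (v + c)"
  have "(cmod (v + c + v))\<^sup>2 + (cmod c)\<^sup>2 = 2 * (cmod (v + c))\<^sup>2 + 2 * (cmod v)\<^sup>2"
    unfolding cmod_power2 by (simp add: power2_eq_square algebra_simps)
  also have "\<dots> \<le> (cmod c)\<^sup>2"
    using power_mono[OF nearest, of 2] by (simp add: tight power_mult_distrib)
  finally have "v + c + v = 0" by simp
  then show "c = - 2 * v" by algebra
qed

lemma nearest_lattice_point:
  assumes "closed (Z_adjoin \<tau>)"
  shows "\<exists>u\<in>Z_adjoin \<tau>. z - u \<in> voronoi \<tau>"
proof -
  obtain u where u: "u \<in> Z_adjoin \<tau>" "\<And>y. y \<in> Z_adjoin \<tau> \<Longrightarrow> dist z u \<le> dist z y"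
    using distance_attains_inf[OF assms] Z_adjoin_0 by (metis empty_iff)
  have "cmod (z - u) \<le> cmod (z - u - y)" if "y \<in> Z_adjoin \<tau>" for y
    using u(2)[of "u + y"] u(1) that by (auto simp: dist_norm algebra_simps)
  with u(1) show ?thesis by (auto simp: voronoi_def)
qed

lemma inner_eq_0_iff_ii_multiple:
  assumes "e \<noteq> 0"
  shows "x \<bullet> e = 0 \<longleftrightarrow> (\<exists>\<alpha>::real. x = \<alpha> *\<^sub>R (\<i> * e))"
proof
  assume "x \<bullet> e = 0"
  then have "x * cnj e = Im (x * cnj e) *\<^sub>R \<i>"
    by (simp add: complex_eq_iff inner_complex_def)
  then have "x * cnj e * e = Im (x * cnj e) *\<^sub>R (\<i> * e)"
    by (metis mult_scaleR_left)
  moreover have "x * cnj e * e = (cmod e)\<^sup>2 *\<^sub>R x"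
    by (simp only: scaleR_conv_of_real complex_norm_square mult_ac)
  ultimately have "(cmod e)\<^sup>2 *\<^sub>R x = (cmod e)\<^sup>2 *\<^sub>R ((Im (x * cnj e) / (cmod e)\<^sup>2) *\<^sub>R (\<i> * e))"
    using assms by simp
  then have "x = (Im (x * cnj e) / (cmod e)\<^sup>2) *\<^sub>R (\<i> * e)"
    using assms by (simp only: scaleR_cancel_left) simp
  then show "\<exists>\<alpha>::real. x = \<alpha> *\<^sub>R (\<i> * e)" by blast
qed (auto simp: inner_complex_def)

text \<open>The point \<open>u\<close> is the mirror image of \<open>0\<close> in the line through \<open>a\<close> and \<open>b\<close>.\<close>

lemma bisector_unique:
  fixes a b u y :: complex
  assumes "a \<noteq> b" "u \<noteq> 0" "y \<noteq> 0"
    and "a \<in> bisector u" "b \<in> bisector u"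
    and "a \<in> bisector y" "b \<in> bisector y"
  shows "u = y"
proof -
  define normal where "normal = \<i> * (a - b)"
  have scale: "\<exists>\<alpha>. x = \<alpha> *\<^sub>R normal \<and> 2 * (a \<bullet> normal) = \<alpha> * (normal \<bullet> normal)"
    if "x \<noteq> 0" "a \<in> bisector x" "b \<in> bisector x" for x
  proof -
    have "x \<bullet> (a - b) = 0"
      using that by (simp add: in_bisector_iff inner_diff_right inner_commute)
    then obtain \<alpha> where x: "x = \<alpha> *\<^sub>R normal"
      using inner_eq_0_iff_ii_multiple[of "a - b" x] assms(1) by (auto simp: normal_def)
    with that(1,2) show ?thesis by (auto simp: in_bisector_iff)
  qed
  obtain \<alpha> \<beta> where "u = \<alpha> *\<^sub>R normal" "y = \<beta> *\<^sub>R normal" "\<alpha> * (normal \<bullet> normal) = \<beta> * (normal \<bullet> normal)"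
    using scale assms by metis
  then show ?thesis
    using assms(2) by auto
qed

lemma bisector_affine_combination:
  fixes a b y z :: complex
  assumes "a \<noteq> b" "y \<noteq> 0" "a \<in> bisector y" "b \<in> bisector y" "z \<in> bisector y"
  obtains t :: real where "z = (1 - t) *\<^sub>R a + t *\<^sub>R b"
proof -
  have "(z - a) \<bullet> y = 0" "(b - a) \<bullet> y = 0"
    using assms by (simp_all add: in_bisector_iff inner_diff_left)
  then obtain \<alpha> \<beta> where \<alpha>: "z - a = \<alpha> *\<^sub>R (\<i> * y)" and \<beta>: "b - a = \<beta> *\<^sub>R (\<i> * y)"
    using inner_eq_0_iff_ii_multiple[OF \<open>y \<noteq> 0\<close>] by metis
  have "z - a = (\<alpha> / \<beta>) *\<^sub>R (b - a)"
    using \<open>a \<noteq> b\<close> \<beta> by (auto simp: \<alpha>)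
  then have "z = (1 - \<alpha> / \<beta>) *\<^sub>R a + (\<alpha> / \<beta>) *\<^sub>R b"
    by (simp add: algebra_simps)
  then show thesis by (rule that)
qed

lemma affine_combination_parameter_nonneg:
  fixes a b y :: "'a::real_inner"
  assumes "((1 - t) *\<^sub>R a + t *\<^sub>R b) \<bullet> y \<le> a \<bullet> y" "b \<bullet> y < a \<bullet> y"
  shows "0 \<le> t"
proof -
  have "0 \<le> t * (a \<bullet> y - b \<bullet> y)"
    using assms(1) by (simp add: inner_add_left algebra_simps)
  with assms(2) show ?thesis by (simp add: zero_le_mult_iff)
qed

section \<open>Polygonal Voronoi cells\<close>

lemma (in linorder) sorted_key_list_of_set_eqI:
  assumes "sorted_wrt (<) (map f l)"
  shows "sorted_key_list_of_set f (set l) = l"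
proof -
  have "distinct (map f l)" "sorted (map f l)"
    using assms by (simp_all add: strict_sorted_iff)
  then interpret folding_insort_key "(\<le>)" "(<)" "set l" f
    by unfold_locales (simp add: distinct_map)
  show ?thesis
    using \<open>distinct (map f l)\<close> \<open>sorted (map f l)\<close>
    by (intro idem_if_sorted_distinct) (auto simp: distinct_map)
qed

lemma Arg2pi_less_upper_half:
  assumes "Im a > 0" "Im b > 0" "Im (b / a) > 0"
  shows "Arg2pi a < Arg2pi b"
proof (rule ccontr)
  assume "\<not> Arg2pi a < Arg2pi b"
  then have "Arg2pi b \<le> Arg2pi a" by simp
  then have "Arg2pi (a / b) = Arg2pi a - Arg2pi b"
    using assms by (intro Arg2pi_divide) auto
  also have "\<dots> < pi"
    using Arg2pi_lt_pi[of a] Arg2pi_lt_pi[of b] assms by linarith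
  finally have "0 \<le> Im (a / b)"
    using Arg2pi_le_pi[of "a / b"] by simp
  with assms(3) show False
    by (simp add: Im_complex_div_ge_0 Im_complex_div_gt_0 algebra_simps)
qed

text \<open>A centrally symmetric cell with counter-clockwise vertices \<open>v 0, \<dots>, v (2 * r - 1)\<close>. As
  \<open>v k + v (k + 1)\<close> is twice the midpoint of an edge, the assumptions say that every edge is part of the
  bisector of \<open>0\<close> and a lattice point, and that these bisectors cut out the cell. The conditions on real
  and imaginary parts make \<open>v 0\<close> the start vertex.\<close>

locale voronoi_polygon =
  fixes \<tau> :: complex and r :: nat and v :: "nat \<Rightarrow> complex"
  assumes half_vertices: "r = 2 \<or> r = 3"
    and antiperiodic: "v (k + r) = - v k"
    and half_ccw: "k < l \<Longrightarrow> l < r \<Longrightarrow> 0 < Im (v l * cnj (v k))"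
    and half_neighbour: "k < r \<Longrightarrow> v k + v (Suc k) \<in> Z_adjoin \<tau>"
    and half_voronoi: "k < r \<Longrightarrow> v k \<in> voronoi \<tau>"
    and voronoi_if_strips: "(\<And>k. k < r \<Longrightarrow> z \<in> strip (v k + v (Suc k))) \<Longrightarrow> z \<in> voronoi \<tau>"
    and Re_start: "Re (v 0) = 1/2"
    and half_Re_less: "0 < k \<Longrightarrow> k < r \<Longrightarrow> Re (v k) < 1/2"
    and half_Im_pos: "k < r \<Longrightarrow> 0 < Im (v k)"
    and last_half_vertex: "v (r - 1) = v 0 - 1"
    and inequivalent: "r = 3 \<Longrightarrow> v 1 - v 2 \<notin> Z_adjoin \<tau>"
begin

definition neighbour :: "nat \<Rightarrow> complex" where
  "neighbour k = v k + v (Suc k)"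

lemma antiperiodic_induct [case_names half shift]:
  assumes "\<And>k. k < r \<Longrightarrow> P k" "\<And>k. P k \<Longrightarrow> P (k + r)"
  shows "P k"
proof (induction k rule: less_induct)
  case (less k)
  show ?case
  proof (cases "k < r")
    case False
    then have "P (k - r)" using less half_vertices by auto
    with assms(2)[of "k - r"] False show ?thesis by simp
  qed (rule assms(1))
qed

lemma antiperiodic_Suc: "v (Suc (k + r)) = - v (Suc k)"
  using antiperiodic[of "Suc k"] by simp

lemma neighbour_antiperiodic: "neighbour (k + r) = - neighbour k"
  by (simp add: neighbour_def antiperiodic antiperiodic_Suc)

lemma periodic: "v (k + 2 * r * n) = v k"
proof (induction n)
  case (Suc n)
  have "v (k + 2 * r * Suc n) = v (k + 2 * r * n + r + r)"
    by (rule arg_cong) simp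
  then show ?case using Suc by (simp only: antiperiodic minus_minus)
qed simp

lemma obtain_predecessor:
  obtains i where "v (Suc i) = v k" "v (Suc (Suc i)) = v (Suc k)"
proof
  have "Suc (k + 2 * r - 1) = k + 2 * r * 1" "Suc (Suc (k + 2 * r - 1)) = Suc k + 2 * r * 1"
    using half_vertices by auto
  then show "v (Suc (k + 2 * r - 1)) = v k" "v (Suc (Suc (k + 2 * r - 1))) = v (Suc k)"
    by (simp_all only: periodic)
qed

lemma vertex_in_voronoi: "v k \<in> voronoi \<tau>"
  by (induction k rule: antiperiodic_induct) (simp_all add: half_voronoi antiperiodic uminus_in_voronoi)

lemma neighbour_in_Z_adjoin: "neighbour k \<in> Z_adjoin \<tau>"
proof (induction k rule: antiperiodic_induct)
  case (half k)
  then show ?case using half_neighbour by (simp add: neighbour_def)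
next
  case (shift k)
  then show ?case by (auto simp: neighbour_antiperiodic)
qed

lemma ccw: "0 < Im (v (Suc k) * cnj (v k))"
proof (induction k rule: antiperiodic_induct)
  case (half k)
  show ?case
  proof (cases "Suc k < r")
    case False
    with half have "Suc k = 0 + r" "0 < k" using half_vertices by auto
    then have "v (Suc k) = - v 0" using antiperiodic by metis
    with half_ccw[OF \<open>0 < k\<close> half] show ?thesis by (simp add: algebra_simps)
  qed (rule half_ccw[OF lessI])
qed (simp add: antiperiodic antiperiodic_Suc)

lemma neighbour_nonzero: "neighbour k \<noteq> 0"
proof
  assume "neighbour k = 0"
  then have "v (Suc k) = - v k" by (simp add: neighbour_def eq_neg_iff_add_eq_0 add.commute)
  with ccw[of k] show False by simp
qed

lemma vertex_Suc_neq: "v (Suc k) \<noteq> v k"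
  using ccw[of k] by auto

lemma neighbour_Suc_neq: "neighbour (Suc k) \<noteq> neighbour k"
proof
  assume "neighbour (Suc k) = neighbour k"
  then have "v (Suc (Suc k)) = v k" by (simp add: neighbour_def)
  with ccw[of k] ccw[of "Suc k"] show False by (simp add: algebra_simps)
qed

lemma edge_on_bisector:
  "v k \<in> bisector (neighbour k)"
  "v (Suc k) \<in> bisector (neighbour k)"
proof -
  have "v k - neighbour k \<in> voronoi \<tau>" "v (Suc k) - neighbour k \<in> voronoi \<tau>"
    using vertex_in_voronoi uminus_in_voronoi by (simp_all add: neighbour_def)
  then show "v k \<in> bisector (neighbour k)"
    "v (Suc k) \<in> bisector (neighbour k)"
    by (simp_all add: voronoi_diff_iff vertex_in_voronoi neighbour_in_Z_adjoin)
qed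

lemma bisector_neighbour_eq:
  assumes "a \<noteq> b" "u \<noteq> 0" "a \<in> bisector u" "b \<in> bisector u"
    and "a \<in> bisector (neighbour k)"
    and "b \<in> bisector (neighbour k)"
  shows "u = neighbour k"
  using bisector_unique[OF assms(1,2) neighbour_nonzero assms(3-)] .

lemma open_edge_subset: "open_segment (v k) (v (Suc k)) \<subseteq> voronoi \<tau>"
  using convex_voronoi vertex_in_voronoi convex_contains_open_segment by blast

lemma open_edge_tie:
  assumes z: "z \<in> open_segment (v k) (v (Suc k))" and u: "u \<in> Z_adjoin \<tau>" "z - u \<in> voronoi \<tau>"
  shows "u = 0 \<or> u = neighbour k"
proof -
  have "z \<in> bisector u"
    using voronoi_diff_iff[of z \<tau> u] u z open_edge_subset by blast
  note tie = bisector_if_open_segment_meets[OF vertex_in_voronoi vertex_in_voronoi z u(1) this]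
  show ?thesis
    using bisector_neighbour_eq[OF vertex_Suc_neq[symmetric] _ tie edge_on_bisector] by blast
qed

lemma adjacent_vertex_off_bisector:
  "2 * (v (Suc (Suc k)) \<bullet> neighbour k) < neighbour k \<bullet> neighbour k"
  "2 * (v k \<bullet> neighbour (Suc k)) < neighbour (Suc k) \<bullet> neighbour (Suc k)"
proof -
  have "v (Suc (Suc k)) \<notin> bisector (neighbour k)"
    using bisector_neighbour_eq[OF vertex_Suc_neq[of "Suc k"] neighbour_nonzero[of k], of "Suc k"]
      edge_on_bisector neighbour_Suc_neq[of k] by metis
  moreover have "v k \<notin> bisector (neighbour (Suc k))"
    using bisector_neighbour_eq[OF vertex_Suc_neq[of k] neighbour_nonzero[of "Suc k"], of k]
      edge_on_bisector neighbour_Suc_neq[of k] by metis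
  ultimately show
    "2 * (v (Suc (Suc k)) \<bullet> neighbour k) < neighbour k \<bullet> neighbour k"
    "2 * (v k \<bullet> neighbour (Suc k)) < neighbour (Suc k) \<bullet> neighbour (Suc k)"
    using in_voronoiD[OF vertex_in_voronoi neighbour_in_Z_adjoin]
    by (simp_all add: in_bisector_iff less_le)
qed

lemma bisector_in_voronoi_subset_edge:
  assumes z: "z \<in> voronoi \<tau>" and tie: "z \<in> bisector (neighbour k)"
  shows "z \<in> closed_segment (v k) (v (Suc k))"
proof -
  obtain i where i: "v (Suc i) = v k" "v (Suc (Suc i)) = v (Suc k)"
    by (rule obtain_predecessor)
  then have "neighbour k = neighbour (Suc i)"
    by (simp add: neighbour_def)
  then obtain t where z_eq: "z = (1 - t) *\<^sub>R v (Suc i) + t *\<^sub>R v (Suc (Suc i))"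
    using tie
      bisector_affine_combination[OF vertex_Suc_neq[symmetric] neighbour_nonzero edge_on_bisector]
    by metis
  have bound: "2 * (z \<bullet> neighbour j) \<le> neighbour j \<bullet> neighbour j" for j
    using in_voronoiD[OF z neighbour_in_Z_adjoin] .
  have "0 \<le> t"
    using bound[of i] edge_on_bisector(2)[of i] adjacent_vertex_off_bisector(1)[of i]
    by (intro affine_combination_parameter_nonneg[of t "v (Suc i)" "v (Suc (Suc i))" "neighbour i"])
      (simp_all add: in_bisector_iff flip: z_eq)
  moreover have "z = (1 - (1 - t)) *\<^sub>R v (Suc (Suc i)) + (1 - t) *\<^sub>R v (Suc i)"
    by (simp add: z_eq)
  then have "0 \<le> 1 - t"
    using bound[of "Suc (Suc i)"] edge_on_bisector(1)[of "Suc (Suc i)"]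
      adjacent_vertex_off_bisector(2)[of "Suc i"]
    by (intro affine_combination_parameter_nonneg[of "1 - t" "v (Suc (Suc i))" "v (Suc i)"
        "neighbour (Suc (Suc i))"]) (simp_all add: in_bisector_iff)
  ultimately show ?thesis
    using z_eq by (auto simp: in_segment i)
qed

lemma voronoi_cases [consumes 1, case_names interior edge]:
  assumes z: "z \<in> voronoi \<tau>"
  obtains "z \<in> interior (voronoi \<tau>)"
  | k where "k < 2 * r" "z \<in> closed_segment (v k) (v (Suc k))"
proof (cases "\<forall>k<r. 2 * \<bar>z \<bullet> neighbour k\<bar> < neighbour k \<bullet> neighbour k")
  case True
  define S where "S = (\<Inter>k<r. {z. 2 * \<bar>z \<bullet> neighbour k\<bar> < neighbour k \<bullet> neighbour k})"
  have "open S"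
    unfolding S_def by (intro open_INT ballI open_Collect_less continuous_intros) simp
  moreover have "S \<subseteq> voronoi \<tau>"
    using voronoi_if_strips by (force simp: S_def strip_def neighbour_def less_imp_le)
  moreover have "z \<in> S"
    using True by (simp add: S_def)
  ultimately have "z \<in> interior (voronoi \<tau>)"
    using interior_maximal by blast
  then show ?thesis by (rule that)
next
  case False
  then obtain k where k: "k < r" "neighbour k \<bullet> neighbour k \<le> 2 * \<bar>z \<bullet> neighbour k\<bar>"
    by (auto simp: not_less)
  have bound: "2 * (z \<bullet> neighbour j) \<le> neighbour j \<bullet> neighbour j" for j
    using in_voronoiD[OF z neighbour_in_Z_adjoin] .
  have "\<exists>j<2 * r. z \<in> bisector (neighbour j)"
  proof (cases "z \<bullet> neighbour k \<ge> 0")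
    case True
    then show ?thesis using k bound[of k] by (intro exI[of _ k]) (auto simp: in_bisector_iff)
  next
    case False
    then show ?thesis
      using k bound[of "k + r"]
      by (intro exI[of _ "k + r"]) (auto simp: in_bisector_iff neighbour_antiperiodic)
  qed
  then show ?thesis
    using bisector_in_voronoi_subset_edge[OF z] that(2) by metis
qed

lemma vertex_extreme_point: "v k extreme_point_of voronoi \<tau>"
proof -
  obtain i where i: "v (Suc i) = v k" by (rule obtain_predecessor)
  have "v (Suc i) \<notin> open_segment a b" if ab: "a \<in> voronoi \<tau>" "b \<in> voronoi \<tau>" for a b
  proof
    assume seg: "v (Suc i) \<in> open_segment a b"
    note tie = bisector_if_open_segment_meets[OF ab seg neighbour_in_Z_adjoin]
    have "neighbour (Suc i) = neighbour i"
      using seg tie[OF edge_on_bisector(2)] tie[OF edge_on_bisector(1)]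
      by (intro bisector_neighbour_eq[of a b] neighbour_nonzero) auto
    with neighbour_Suc_neq show False by blast
  qed
  then show ?thesis
    using vertex_in_voronoi by (auto simp: extreme_point_of_def simp flip: i)
qed

lemma voronoi_vertices_eq: "voronoi_vertices \<tau> = v ` {..<2 * r}"
proof
  show "v ` {..<2 * r} \<subseteq> voronoi_vertices \<tau>"
    using vertex_extreme_point by (auto simp: voronoi_vertices_def)
  show "voronoi_vertices \<tau> \<subseteq> v ` {..<2 * r}"
  proof
    fix z assume "z \<in> voronoi_vertices \<tau>"
    then have z: "z extreme_point_of voronoi \<tau>" by (simp add: voronoi_vertices_def)
    then have "z \<in> voronoi \<tau>" by (simp add: extreme_point_of_def)
    then show "z \<in> v ` {..<2 * r}"
    proof (cases rule: voronoi_cases)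
      case interior
      with extreme_point_not_in_interior[OF z] show ?thesis by contradiction
    next
      case (edge k)
      moreover have "z \<notin> open_segment (v k) (v (Suc k))"
        using z vertex_in_voronoi by (simp add: extreme_point_of_def)
      ultimately have "z = v k \<or> z = v (Suc k)"
        by (auto simp: closed_segment_eq_open)
      moreover have "v (Suc k) \<in> v ` {..<2 * r}"
      proof (cases "Suc k < 2 * r")
        case False
        with edge(1) have "Suc k = 0 + 2 * r * 1" by simp
        then have "v (Suc k) = v 0" using periodic by metis
        then show ?thesis using edge(1) by auto
      qed auto
      ultimately show ?thesis using edge(1) by auto
    qed
  qed
qed

lemma start_vertex_eq: "start_vertex \<tau> = v 0"
  unfolding start_vertex_def
proof (rule the_equality)
  show "v 0 \<in> voronoi_vertices \<tau> \<and> Re (v 0) = 1 / 2 \<and> 0 < Im (v 0)"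
    using half_vertices Re_start half_Im_pos by (auto simp: voronoi_vertices_eq)
  fix z assume z: "z \<in> voronoi_vertices \<tau> \<and> Re z = 1 / 2 \<and> 0 < Im z"
  then obtain k where k: "k < 2 * r" "z = v k" by (auto simp: voronoi_vertices_eq)
  have "k < r"
  proof (rule ccontr)
    assume "\<not> k < r"
    with k have "z = - v (k - r)" "k - r < r" using antiperiodic[of "k - r"] by simp_all
    with z half_Im_pos[of "k - r"] show False by simp
  qed
  with half_Re_less[of k] z k(2) show "z = v 0" by (cases "k = 0") auto
qed

lemma Arg2pi_vertex_half:
  assumes "k < l" "l < r"
  shows "Arg2pi (v k / v 0) < Arg2pi (v l / v 0)"
proof (cases "k = 0")
  case True
  have "v 0 \<noteq> 0" using Re_start by auto
  then show ?thesis
    using True half_ccw[OF assms] Arg2pi_lt_pi[of "v l / v 0"] Arg2pi_real[of 1]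
    by (simp add: Im_complex_div_gt_0)
next
  case False
  have "v 0 \<noteq> 0" using Re_start by auto
  then have "v l / v 0 / (v k / v 0) = v l / v k" by simp
  then show ?thesis
    using False assms half_ccw[of 0 k] half_ccw[of 0 l] half_ccw[of k l]
    by (intro Arg2pi_less_upper_half) (auto simp: Im_complex_div_gt_0)
qed

lemma Arg2pi_vertex_less_pi:
  assumes "k < r"
  shows "Arg2pi (v k / v 0) < pi"
proof (cases "k = 0")
  case True
  then show ?thesis using Re_start Arg2pi_real[of 1] by auto
next
  case False
  then show ?thesis
    using half_ccw[of 0 k] assms Arg2pi_lt_pi[of "v k / v 0"] by (simp add: Im_complex_div_gt_0)
qed

lemma Arg2pi_antipodal_vertex:
  assumes "k < r"
  shows "Arg2pi (v (k + r) / v 0) = Arg2pi (v k / v 0) + pi"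
proof -
  have "v k / v 0 \<noteq> 0"
    using half_Im_pos[OF assms] Re_start by auto
  then show ?thesis
    using Arg2pi_vertex_less_pi[OF assms] Arg2pi_minus[of "v k / v 0"] by (simp add: antiperiodic)
qed

lemma Arg2pi_vertex_strict_mono:
  assumes "k < l" "l < 2 * r"
  shows "Arg2pi (v k / v 0) < Arg2pi (v l / v 0)"
proof -
  have shift: "Arg2pi (v j / v 0) = Arg2pi (v (j - r) / v 0) + pi" if "r \<le> j" "j < 2 * r" for j
    using Arg2pi_antipodal_vertex[of "j - r"] that by simp
  consider (upper) "l < r" | (both) "k < r" "r \<le> l" | (lower) "r \<le> k" by linarith
  then show ?thesis
  proof cases
    case upper
    with assms show ?thesis by (intro Arg2pi_vertex_half)
  next
    case both
    then show ?thesis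
      using shift[of l] assms(2) Arg2pi_vertex_less_pi[of k] Arg2pi_ge_0[of "v (l - r) / v 0"] by simp
  next
    case lower
    then show ?thesis
      using shift[of k] shift[of l] Arg2pi_vertex_half[of "k - r" "l - r"] assms by simp
  qed
qed

lemma vertex_list_eq: "vertex_list \<tau> = map v [0..<2 * r]"
  and num_vertices_eq: "num_vertices \<tau> = 2 * r"
proof -
  define \<theta> where "\<theta> = (\<lambda>z. Arg2pi (z / v 0))"
  have sorted: "sorted_wrt (<) (map \<theta> (map v [0..<2 * r]))"
    by (simp add: sorted_wrt_iff_nth_less \<theta>_def Arg2pi_vertex_strict_mono)
  have "sorted_key_list_of_set \<theta> (set (map v [0..<2 * r])) = map v [0..<2 * r]"
    by (rule sorted_key_list_of_set_eqI[OF sorted])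
  then show "vertex_list \<tau> = map v [0..<2 * r]"
    by (simp add: vertex_list_def voronoi_vertices_eq start_vertex_eq lessThan_atLeast0 \<theta>_def)
  have "inj_on v {..<2 * r}"
    using sorted by (auto simp: strict_sorted_iff distinct_map lessThan_atLeast0 intro: inj_on_imageI2)
  then show "num_vertices \<tau> = 2 * r"
    by (simp add: num_vertices_def voronoi_vertices_eq card_image)
qed

lemma vertex_eq: "vertex \<tau> k = v k"
proof -
  have "vertex \<tau> k = v (k mod (2 * r))"
    using half_vertices by (auto simp: vertex_def vertex_list_eq num_vertices_eq)
  also have "\<dots> = v k"
    using periodic[of "k mod (2 * r)" "k div (2 * r)"] by simp
  finally show ?thesis .
qed

lemma edge_midpoint_eq: "edge_midpoint \<tau> k = neighbour k / 2"
  by (simp add: edge_midpoint_def vertex_eq neighbour_def midpoint_def scaleR_conv_of_real)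

section \<open>The restricted cell tiles the plane\<close>

lemma restricted_voronoi_eq:
  "restricted_voronoi \<tau> =
     interior (voronoi \<tau>) \<union> (\<Union>k. open_segment (neighbour k / 2) (v (Suc k)))
     \<union> (\<lambda>k. neighbour k / 2) ` {..<r} \<union> v ` {1..2 * r div 3}"
proof -
  have "(\<Union>k. open_segment (neighbour k / 2) (v (Suc k))) \<subseteq>
    (\<Union>k<2 * r. open_segment (neighbour k / 2) (v (Suc k)))"
  proof
    fix z assume "z \<in> (\<Union>k. open_segment (neighbour k / 2) (v (Suc k)))"
    then obtain k where z: "z \<in> open_segment (neighbour k / 2) (v (Suc k))" by blast
    have "v (k mod (2 * r)) = v k" "v (Suc (k mod (2 * r))) = v (Suc k)"
      using periodic[of "k mod (2 * r)" "k div (2 * r)"]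
        periodic[of "Suc (k mod (2 * r))" "k div (2 * r)"]
      by simp_all
    then show "z \<in> (\<Union>k<2 * r. open_segment (neighbour k / 2) (v (Suc k)))"
      using z half_vertices by (intro UN_I[of "k mod (2 * r)"]) (auto simp: neighbour_def)
  qed
  then have "(\<Union>k<2 * r. open_segment (neighbour k / 2) (v (Suc k))) =
    (\<Union>k. open_segment (neighbour k / 2) (v (Suc k)))"
    by blast
  then show ?thesis
    by (simp add: restricted_voronoi_def num_vertices_eq vertex_eq edge_midpoint_eq lessThan_def)
qed

lemma midpoint_on_open_edge: "neighbour k / 2 \<in> open_segment (v k) (v (Suc k))"
proof -
  have "neighbour k / 2 = midpoint (v k) (v (Suc k))"
    by (simp add: neighbour_def midpoint_def scaleR_conv_of_real)
  then show ?thesis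
    using vertex_Suc_neq[of k] by (metis midpoint_in_open_segment)
qed

lemma second_half_of_edge:
  assumes "z \<in> open_segment (neighbour k / 2) (v (Suc k))"
  shows "z \<in> open_segment (v k) (v (Suc k))" "0 < Im (z * cnj (neighbour k))"
proof -
  obtain t where t: "0 < t" "t < 1" "z = (1 - t) *\<^sub>R (neighbour k / 2) + t *\<^sub>R v (Suc k)"
    using assms by (auto simp: in_segment)
  define s where "s = (1 + t) / 2"
  have "z = (1 - s) *\<^sub>R v k + s *\<^sub>R v (Suc k)"
    by (simp add: t(3) s_def neighbour_def complex_eq_iff field_simps)
  then show "z \<in> open_segment (v k) (v (Suc k))"
    using t vertex_Suc_neq[of k] by (auto simp: in_segment s_def intro!: exI[of _ s])
  have "Im (z * cnj (neighbour k)) = t * Im (v (Suc k) * cnj (v k))"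
    by (simp add: t(3) neighbour_def field_simps)
  then show "0 < Im (z * cnj (neighbour k))"
    using t(1) ccw by simp
qed

definition selected_edge_point :: "nat \<Rightarrow> complex \<Rightarrow> bool" where
  "selected_edge_point k z \<longleftrightarrow> z \<in> open_segment (v k) (v (Suc k)) \<and>
     (0 < Im (z * cnj (neighbour k)) \<or> k < r \<and> Im (z * cnj (neighbour k)) = 0)"

lemma selected_edge_point_on_edge: "selected_edge_point k z \<Longrightarrow> z \<in> open_segment (v k) (v (Suc k))"
  by (simp add: selected_edge_point_def)

lemma restricted_voronoi_cases [consumes 1, case_names interior edge vertex]:
  assumes "z \<in> restricted_voronoi \<tau>"
  obtains "z \<in> interior (voronoi \<tau>)"
  | k where "selected_edge_point k z" | k where "k \<in> {1..2 * r div 3}" "z = v k"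
proof -
  consider (interior) "z \<in> interior (voronoi \<tau>)"
    | (half_edge) k where "z \<in> open_segment (neighbour k / 2) (v (Suc k))"
    | (midpoint) k where "k < r" "z = neighbour k / 2"
    | (vertex) k where "k \<in> {1..2 * r div 3}" "z = v k"
    using assms by (auto simp: restricted_voronoi_eq)
  then show thesis
  proof cases
    case (half_edge k)
    with second_half_of_edge have "selected_edge_point k z"
      by (simp add: selected_edge_point_def)
    then show thesis by (rule that(2))
  next
    case (midpoint k)
    then have "Im (z * cnj (neighbour k)) = 0"
      by (simp only: midpoint(2)) simp
    moreover have "z \<in> open_segment (v k) (v (Suc k))"
      unfolding midpoint(2) by (rule midpoint_on_open_edge)
    ultimately show thesis using that(2) midpoint(1) by (auto simp: selected_edge_point_def)
  qed (use that in auto)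
qed

lemma restricted_voronoi_subset: "restricted_voronoi \<tau> \<subseteq> voronoi \<tau>"
proof
  fix z assume "z \<in> restricted_voronoi \<tau>"
  then show "z \<in> voronoi \<tau>"
  proof (cases rule: restricted_voronoi_cases)
    case (edge k)
    then show ?thesis using selected_edge_point_on_edge open_edge_subset by blast
  qed (use interior_subset vertex_in_voronoi in auto)
qed

text \<open>A vertex has at least three nearest lattice points, a point on an open edge only two.\<close>

lemma vertex_not_equivalent_to_edge:
  assumes z: "z \<in> open_segment (v k) (v (Suc k))" and u: "u \<in> Z_adjoin \<tau>"
  shows "z - u \<noteq> v j"
proof
  obtain i where i: "v (Suc i) = v j" by (rule obtain_predecessor)
  assume "z - u = v j"
  then have "z - (u + y) = v (Suc i) - y" for y by (simp add: i diff_diff_eq)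
  moreover have "v (Suc i) - y \<in> voronoi \<tau> \<and> u + y \<in> Z_adjoin \<tau>"
    if "y \<in> {0, neighbour i, neighbour (Suc i)}" for y
    using that u vertex_in_voronoi neighbour_in_Z_adjoin edge_on_bisector voronoi_diff_iff by auto
  ultimately have "u + y = 0 \<or> u + y = neighbour k" if "y \<in> {0, neighbour i, neighbour (Suc i)}" for y
    using that open_edge_tie[OF z, of "u + y"] by presburger
  then show False
    using neighbour_nonzero neighbour_Suc_neq[of i] by (metis add_left_cancel insert_iff singleton_iff)
qed

lemma half_neighbours_not_opposite:
  assumes "k < r" "l < r"
  shows "neighbour k \<noteq> - neighbour l"
proof
  assume opp: "neighbour k = - neighbour l"
  have Im: "Im (neighbour j) > 0 \<or> neighbour j = - 1" if "j < r" for j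
  proof (cases "Suc j < r")
    case True
    then show ?thesis using half_Im_pos[of j] half_Im_pos[of "Suc j"] by (simp add: neighbour_def)
  next
    case False
    with that have "j = r - 1" "Suc j = 0 + r" by auto
    then show ?thesis
      using last_half_vertex by (simp only: neighbour_def antiperiodic) simp
  qed
  from Im[OF assms(1)] Im[OF assms(2)] opp show False by auto
qed

lemma selected_vertices_inequivalent:
  assumes "k \<in> {1..2 * r div 3}" "l \<in> {1..2 * r div 3}" "v k - v l \<in> Z_adjoin \<tau>"
  shows "k = l"
proof (rule ccontr)
  assume "k \<noteq> l"
  with assms half_vertices have "r = 3" "k = 1 \<and> l = 2 \<or> k = 2 \<and> l = 1" by auto
  with inequivalent Z_adjoin_minus[OF assms(3)] assms(3) show False by auto
qed

text \<open>If \<open>z\<close> and \<open>z - u\<close> lie on edges, then \<open>u\<close> and \<open>- u\<close> are the neighbours across these edges, and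
  the two points are on opposite sides of the respective midpoints.\<close>

lemma selected_edge_points_inequivalent:
  assumes z: "selected_edge_point k z" and zu: "selected_edge_point l (z - u)" and u: "u \<in> Z_adjoin \<tau>"
  shows "u = 0"
proof (rule ccontr)
  assume "u \<noteq> 0"
  have edges: "z \<in> open_segment (v k) (v (Suc k))" "z - u \<in> open_segment (v l) (v (Suc l))"
    using z zu by (simp_all add: selected_edge_point_on_edge)
  then have "z \<in> voronoi \<tau>" "z - u \<in> voronoi \<tau>"
    using open_edge_subset by auto
  then have u_eq: "neighbour k = u" "neighbour l = - u"
    using open_edge_tie[OF edges(1) u] open_edge_tie[OF edges(2) Z_adjoin_minus[OF u]] \<open>u \<noteq> 0\<close> by auto
  have "Im ((z - u) * cnj (neighbour l)) = - Im (z * cnj (neighbour k))"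
    by (simp add: u_eq algebra_simps)
  with z zu have "k < r" "l < r"
    unfolding selected_edge_point_def by linarith+
  with half_neighbours_not_opposite u_eq show False by force
qed

lemma restricted_voronoi_unique:
  assumes z: "z \<in> restricted_voronoi \<tau>" and zu: "z - u \<in> restricted_voronoi \<tau>"
    and u: "u \<in> Z_adjoin \<tau>"
  shows "u = 0"
proof -
  have in_cell: "z \<in> voronoi \<tau>" "z - u \<in> voronoi \<tau>" and minus_u: "- u \<in> Z_adjoin \<tau>"
    using z zu u restricted_voronoi_subset by auto
  have interior: "u = 0" if "z \<in> interior (voronoi \<tau>) \<or> z - u \<in> interior (voronoi \<tau>)"
    using that in_cell(1) interior_voronoi_unique[OF _ u in_cell(2)]
      interior_voronoi_unique[OF _ minus_u, of "z - u"]
    by auto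
  from z show ?thesis
  proof (cases rule: restricted_voronoi_cases)
    case z_vertex: (vertex k)
    from zu show ?thesis
    proof (cases rule: restricted_voronoi_cases)
      case (edge l)
      have "z - u - (- u) \<noteq> v k"
        by (rule vertex_not_equivalent_to_edge[OF selected_edge_point_on_edge[OF edge] minus_u])
      with z_vertex show ?thesis by simp
    next
      case (vertex l)
      then have "v k - v l = u" using z_vertex by (simp flip: vertex(2))
      with selected_vertices_inequivalent[of k l] z_vertex vertex u show ?thesis by auto
    qed (use interior in blast)
  next
    case z_edge: (edge k)
    from zu show ?thesis
    proof (cases rule: restricted_voronoi_cases)
      case (edge l)
      with z_edge u show ?thesis by (intro selected_edge_points_inequivalent)
    next
      case (vertex l)
      with vertex_not_equivalent_to_edge[OF selected_edge_point_on_edge[OF z_edge] u] show ?thesis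
        by blast
    qed (use interior in blast)
  qed (use interior in blast)
qed

lemma vertex_equivalent_to_selected: "\<exists>j\<in>{1..2 * r div 3}. v k - v j \<in> Z_adjoin \<tau>"
proof (induction k rule: nat_induct2)
  case 0
  from half_vertices show ?case
  proof
    assume "r = 2"
    then have "v 0 - v 1 = - neighbour 1"
      using antiperiodic[of 0] by (simp add: neighbour_def numeral_2_eq_2)
    then have "v 0 - v 1 \<in> Z_adjoin \<tau>"
      using neighbour_in_Z_adjoin by auto
    then show ?thesis using \<open>r = 2\<close> by auto
  next
    assume "r = 3"
    then show ?thesis
      using Z_adjoin_diff[OF neighbour_in_Z_adjoin[of 0] neighbour_in_Z_adjoin[of 1]]
      by (intro bexI[of _ 2]) (auto simp: neighbour_def numeral_2_eq_2)
  qed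
next
  case 1
  then show ?case using half_vertices by (intro bexI[of _ 1]) auto
next
  case (step k)
  then obtain j where j: "j \<in> {1..2 * r div 3}" "v k - v j \<in> Z_adjoin \<tau>" by blast
  have "neighbour (Suc k) - neighbour k + (v k - v j) \<in> Z_adjoin \<tau>"
    using neighbour_in_Z_adjoin j(2) by blast
  with j(1) show ?case
    by (intro bexI[of _ j]) (simp_all add: neighbour_def)
qed

lemma first_half_of_edge_translate:
  assumes "z \<in> open_segment (v k) (neighbour k / 2)"
  shows "z - neighbour k \<in> open_segment (neighbour (k + r) / 2) (v (Suc (k + r)))"
proof -
  have "- neighbour k + z \<in> open_segment (- neighbour k + v k) (- neighbour k + neighbour k / 2)"
    using assms by (simp only: open_segment_translation_eq)
  moreover have "- neighbour k + v k = v (Suc (k + r))"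
    "- neighbour k + neighbour k / 2 = neighbour (k + r) / 2"
    by (simp_all add: neighbour_antiperiodic antiperiodic_Suc) (simp add: neighbour_def)
  ultimately show ?thesis
    by (simp only: open_segment_commute) simp
qed

lemma closed_edge_cases [consumes 1, case_names vertex midpoint first_half second_half]:
  assumes "z \<in> closed_segment (v k) (v (Suc k))"
  obtains j where "z = v j" | "z = neighbour k / 2"
  | "z \<in> open_segment (v k) (neighbour k / 2)" | "z \<in> open_segment (neighbour k / 2) (v (Suc k))"
proof -
  have "closed_segment (v k) (v (Suc k)) =
    closed_segment (v k) (neighbour k / 2) \<union> closed_segment (neighbour k / 2) (v (Suc k))"
    using midpoint_on_open_edge by (intro Un_closed_segment[symmetric]) (auto simp: open_segment_def)
  then show thesis
    using assms that by (auto simp: closed_segment_eq_open)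
qed

lemma edge_meets_restricted_voronoi:
  assumes "z \<in> closed_segment (v k) (v (Suc k))" "k < 2 * r"
  shows "\<exists>u\<in>Z_adjoin \<tau>. z - u \<in> restricted_voronoi \<tau>"
  using assms(1)
proof (cases rule: closed_edge_cases)
  case (vertex j)
  obtain i where "i \<in> {1..2 * r div 3}" "v j - v i \<in> Z_adjoin \<tau>"
    using vertex_equivalent_to_selected by blast
  with vertex show ?thesis
    by (intro bexI[of _ "v j - v i"]) (auto simp: restricted_voronoi_eq)
next
  case midpoint
  show ?thesis
  proof (cases "k < r")
    case True
    with midpoint show ?thesis by (intro bexI[of _ 0]) (auto simp: restricted_voronoi_eq)
  next
    case False
    then have "z - neighbour k = neighbour (k - r) / 2" "k - r < r"
      using midpoint assms(2) neighbour_antiperiodic[of "k - r"] by auto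
    then show ?thesis
      using neighbour_in_Z_adjoin by (intro bexI[of _ "neighbour k"]) (auto simp: restricted_voronoi_eq)
  qed
next
  case first_half
  from first_half_of_edge_translate[OF this] show ?thesis
    using neighbour_in_Z_adjoin by (intro bexI[of _ "neighbour k"]) (auto simp: restricted_voronoi_eq)
next
  case second_half
  then show ?thesis by (intro bexI[of _ 0]) (auto simp: restricted_voronoi_eq)
qed

lemma restricted_voronoi_tiling:
  assumes "closed (Z_adjoin \<tau>)"
  shows "\<exists>!u. u \<in> Z_adjoin \<tau> \<and> z - u \<in> restricted_voronoi \<tau>"
proof -
  obtain u where u: "u \<in> Z_adjoin \<tau>" "z - u \<in> voronoi \<tau>"
    using nearest_lattice_point[OF assms] by blast
  from u(2) obtain y where y: "y \<in> Z_adjoin \<tau>" "z - u - y \<in> restricted_voronoi \<tau>"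
  proof (cases rule: voronoi_cases)
    case interior
    then show thesis using that[of 0] by (auto simp: restricted_voronoi_eq)
  next
    case (edge k)
    then show thesis using that edge_meets_restricted_voronoi by blast
  qed
  show ?thesis
  proof (rule ex1I[of _ "u + y"])
    show "u + y \<in> Z_adjoin \<tau> \<and> z - (u + y) \<in> restricted_voronoi \<tau>"
      using u y by (auto simp: diff_diff_eq)
    fix x assume x: "x \<in> Z_adjoin \<tau> \<and> z - x \<in> restricted_voronoi \<tau>"
    then have "x - (u + y) = 0"
      using u y by (intro restricted_voronoi_unique[of "z - (u + y)"]) (auto simp: diff_diff_eq)
    then show "x = u + y" by simp
  qed
qed

end

section \<open>Lattices with a reduced basis\<close>

lemma abs_int_le_square: "\<bar>real_of_int k\<bar> \<le> (real_of_int k)\<^sup>2"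
  using self_le_power[of "\<bar>k\<bar>" 2] by (cases "k = 0") (auto simp flip: of_int_abs of_int_power)

lemma twice_mult_int_le:
  fixes x c :: real
  assumes "2 * \<bar>x\<bar> \<le> c"
  shows "2 * (of_int k * x) \<le> (of_int k)\<^sup>2 * c"
proof -
  have "2 * (of_int k * x) \<le> \<bar>of_int k\<bar> * (2 * \<bar>x\<bar>)"
    using abs_ge_self[of "of_int k * x"] by (simp add: abs_mult)
  also have "\<dots> \<le> (of_int k)\<^sup>2 * c"
    using assms abs_int_le_square by (intro mult_mono) auto
  finally show ?thesis .
qed

lemma strip_acute_combination:
  fixes a b z :: "'a::real_inner"
  assumes "z \<in> strip a" "z \<in> strip b" "0 \<le> a \<bullet> b"
    and "u = of_int i *\<^sub>R a + of_int j *\<^sub>R b" "0 \<le> i * j"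
  shows "2 * (z \<bullet> u) \<le> u \<bullet> u"
proof -
  have "2 * (z \<bullet> u) = 2 * (of_int i * (z \<bullet> a)) + 2 * (of_int j * (z \<bullet> b))"
    by (simp add: assms(4) inner_add_right)
  also have "\<dots> \<le> (of_int i)\<^sup>2 * (a \<bullet> a) + (of_int j)\<^sup>2 * (b \<bullet> b)"
    using assms(1,2) by (intro add_mono twice_mult_int_le) (simp_all add: strip_def)
  also have "\<dots> \<le> (of_int i)\<^sup>2 * (a \<bullet> a) + (of_int j)\<^sup>2 * (b \<bullet> b) + 2 * (of_int (i * j) * (a \<bullet> b))"
    using assms(3,5) by (simp del: of_int_mult)
  also have "\<dots> = u \<bullet> u"
    by (simp add: assms(4) inner_add_left inner_add_right inner_commute[of b a] power2_eq_square
        algebra_simps)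
  finally show ?thesis .
qed

lemma acute_basis_cases:
  fixes i j :: int
  obtains (first) "0 \<le> i * j" | (second) "0 \<le> (i + j) * - i" | (third) "0 \<le> (i + j) * - j"
  by (cases "0 \<le> i"; cases "0 \<le> j"; cases "0 \<le> i + j")
    (auto simp: mult_le_0_iff zero_le_mult_iff)

locale reduced_lattice =
  fixes \<tau> \<omega> :: complex
  assumes lattice: "z \<in> Z_adjoin \<tau> \<longleftrightarrow> (\<exists>i j :: int. z = of_int i + of_int j * \<omega>)"
    and Im_pos: "0 < Im \<omega>" and Re_nonneg: "0 \<le> Re \<omega>" and Re_less_1: "Re \<omega> < 1"
    and acute: "Re \<omega> < (cmod \<omega>)\<^sup>2"
begin

lemma basis_in_Z_adjoin: "\<omega> \<in> Z_adjoin \<tau>" "\<omega> - 1 \<in> Z_adjoin \<tau>" "1 \<in> Z_adjoin \<tau>"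
proof -
  have "of_int i + of_int j * \<omega> \<in> Z_adjoin \<tau>" for i j :: int
    using lattice by blast
  from this[of 0 1] this[of "-1" 1] this[of 1 0]
  show "\<omega> \<in> Z_adjoin \<tau>" "\<omega> - 1 \<in> Z_adjoin \<tau>" "1 \<in> Z_adjoin \<tau>"
    by simp_all
qed

lemma in_voronoi_if_strips:
  assumes "z \<in> strip 1" "z \<in> strip \<omega>" "z \<in> strip (\<omega> - 1)"
  shows "z \<in> voronoi \<tau>"
proof -
  have angles: "0 \<le> 1 \<bullet> \<omega>" "0 \<le> \<omega> \<bullet> (\<omega> - 1)" "0 \<le> 1 \<bullet> (1 - \<omega>)"
    using Re_nonneg Re_less_1 acute
    by (simp_all add: inner_diff_right inner_commute[of _ 1] power2_norm_eq_inner)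
  have opposite: "z \<in> strip (1 - \<omega>)"
    using assms(3) strip_uminus[of "\<omega> - 1"] by simp
  have "2 * (z \<bullet> u) \<le> u \<bullet> u" if u: "u = of_int i + of_int j * \<omega>" for u and i j :: int
  proof (cases rule: acute_basis_cases[of i j])
    case first
    then show ?thesis
      using assms angles(1) u
      by (intro strip_acute_combination[of z 1 \<omega> u i j]) (auto simp: scaleR_conv_of_real)
  next
    case second
    then show ?thesis
      using assms angles(2) u
      by (intro strip_acute_combination[of z \<omega> "\<omega> - 1" u "i + j" "- i"])
        (auto simp: scaleR_conv_of_real algebra_simps)
  next
    case third
    then show ?thesis
      using assms angles(3) opposite u
      by (intro strip_acute_combination[of z 1 "1 - \<omega>" u "i + j" "- j"])
        (auto simp: scaleR_conv_of_real algebra_simps)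
  qed
  then show "z \<in> voronoi \<tau>"
    using lattice by (auto simp: in_voronoi_iff)
qed

text \<open>The heights are those of the circumcentres of the triangles \<open>0, 1, \<omega>\<close> and \<open>0, \<omega>, \<omega> - 1\<close>. If
  \<open>Re \<omega> = 0\<close>, they agree, and the hexagon degenerates to a rectangle.\<close>

definition shoulder_height :: real where
  "shoulder_height = (Im \<omega> - Re \<omega> * (1 - Re \<omega>) / Im \<omega>) / 2"

definition apex_height :: real where
  "apex_height = (Im \<omega> + Re \<omega> * (1 - Re \<omega>) / Im \<omega>) / 2"

definition half_count :: nat where
  "half_count = (if Re \<omega> = 0 then 2 else 3)"

definition corner :: "nat \<Rightarrow> complex" where
  "corner k = (-1) ^ (k div half_count) *
     (if k mod half_count = 0 then Complex (1/2) shoulder_height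
      else if k mod half_count = 1 then Complex (Re \<omega> - 1/2) apex_height
      else Complex (-1/2) shoulder_height)"

lemma Im_mult_shoulder_height: "Im \<omega> * shoulder_height = ((Im \<omega>)\<^sup>2 + (Re \<omega>)\<^sup>2 - Re \<omega>) / 2"
  and Im_mult_apex_height: "Im \<omega> * apex_height = ((Im \<omega>)\<^sup>2 + Re \<omega> - (Re \<omega>)\<^sup>2) / 2"
  using Im_pos by (simp_all add: shoulder_height_def apex_height_def power2_eq_square field_simps)

lemma shoulder_add_apex_height: "shoulder_height + apex_height = Im \<omega>"
  using Im_pos by (simp add: shoulder_height_def apex_height_def field_simps)

lemma shoulder_le_apex_height: "shoulder_height \<le> apex_height"
  using Im_pos Re_nonneg Re_less_1 by (simp add: shoulder_height_def apex_height_def)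

lemma shoulder_height_pos: "0 < shoulder_height"
proof -
  have "0 < Im \<omega> * shoulder_height"
    using acute by (simp add: Im_mult_shoulder_height cmod_power2)
  then show ?thesis
    using Im_pos by (simp add: zero_less_mult_iff)
qed

lemma corner_simps:
  "corner 0 = Complex (1/2) shoulder_height" "corner (Suc 0) = Complex (Re \<omega> - 1/2) apex_height"
  "Re \<omega> \<noteq> 0 \<Longrightarrow> corner 2 = Complex (-1/2) shoulder_height" "corner (k + half_count) = - corner k"
  by (simp_all add: corner_def half_count_def)

lemma less_half_count_cases:
  assumes "k < half_count"
  obtains "k = 0" | "k = Suc 0" | "k = 2" "Re \<omega> \<noteq> 0"
  using assms that
  by (fastforce simp: half_count_def less_Suc_eq numeral_3_eq_3 numeral_2_eq_2 split: if_splits)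

lemma corner_sums:
  "corner 0 + corner (Suc 0) = \<omega>"
  "Re \<omega> \<noteq> 0 \<Longrightarrow> corner (Suc 0) + corner 2 = \<omega> - 1"
  "corner (half_count - Suc 0) + corner half_count = - 1"
proof -
  show "corner 0 + corner (Suc 0) = \<omega>" and "Re \<omega> \<noteq> 0 \<Longrightarrow> corner (Suc 0) + corner 2 = \<omega> - 1"
    using shoulder_add_apex_height by (simp_all add: corner_simps complex_eq_iff)
  have "apex_height = shoulder_height" if "Re \<omega> = 0"
    using that by (simp add: shoulder_height_def apex_height_def)
  then have "corner (half_count - 1) = corner 0 - 1"
    by (simp add: half_count_def corner_simps complex_eq_iff)
  then show "corner (half_count - Suc 0) + corner half_count = - 1"
    using corner_simps(4)[of 0] by simp
qed

lemma corner_in_voronoi: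
  assumes "k < half_count"
  shows "corner k \<in> voronoi \<tau>"
proof -
  have strips: "Complex x y \<in> voronoi \<tau>"
    if "2 * \<bar>x\<bar> \<le> 1" "2 * \<bar>x * Re \<omega> + Im \<omega> * y\<bar> \<le> (Re \<omega>)\<^sup>2 + (Im \<omega>)\<^sup>2"
      "2 * \<bar>x * Re \<omega> + Im \<omega> * y - x\<bar> \<le> (Re \<omega>)\<^sup>2 + (Im \<omega>)\<^sup>2 - 2 * Re \<omega> + 1" for x y
    using that
    by (intro in_voronoi_if_strips)
      (simp_all add: strip_def inner_complex_def power2_eq_square algebra_simps)
  have "(Im \<omega>)\<^sup>2 + (Re \<omega>)\<^sup>2 > Re \<omega>"
    using acute by (simp add: cmod_power2)
  moreover have "(Re \<omega> - 1/2) * Re \<omega> = (Re \<omega>)\<^sup>2 - Re \<omega> / 2"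
    by (simp add: power2_eq_square algebra_simps)
  moreover note Re_nonneg Re_less_1 Im_mult_shoulder_height Im_mult_apex_height
  ultimately have
    "Complex (1/2) shoulder_height \<in> voronoi \<tau>" "Complex (Re \<omega> - 1/2) apex_height \<in> voronoi \<tau>"
    "Complex (-1/2) shoulder_height \<in> voronoi \<tau>"
    by (intro strips; argo)+
  with assms show ?thesis
    by (cases rule: less_half_count_cases) (simp_all add: corner_simps)
qed

lemma corner_ccw:
  assumes "k < l" "l < half_count"
  shows "0 < Im (corner l * cnj (corner k))"
proof -
  have "0 < (1 - Re \<omega>) * shoulder_height"
    using Re_less_1 shoulder_height_pos by simp
  then have "0 < apex_height / 2 - (Re \<omega> - 1/2) * shoulder_height"
    using shoulder_le_apex_height by (simp add: algebra_simps)
  moreover have "0 < apex_height / 2 + shoulder_height * (Re \<omega> - 1/2)" if "Re \<omega> \<noteq> 0"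
  proof -
    have "0 < Re \<omega> * shoulder_height"
      using that Re_nonneg shoulder_height_pos by simp
    then show ?thesis using shoulder_le_apex_height by (simp add: algebra_simps)
  qed
  ultimately show ?thesis
    using shoulder_height_pos by (cases rule: less_half_count_cases[OF assms(2)])
      (use assms(1) in \<open>auto simp: corner_simps less_2_cases_iff\<close>)
qed

lemma corners_inequivalent:
  assumes "Re \<omega> \<noteq> 0"
  shows "corner (Suc 0) - corner 2 \<notin> Z_adjoin \<tau>"
proof
  assume "corner (Suc 0) - corner 2 \<in> Z_adjoin \<tau>"
  then obtain i j :: int where "corner (Suc 0) - corner 2 = of_int i + of_int j * \<omega>"
    using lattice by blast
  from arg_cong[OF this, of Im] have "apex_height - shoulder_height = of_int j * Im \<omega>"
    using assms by (simp add: corner_simps)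
  moreover have "0 < apex_height - shoulder_height"
    using assms Re_nonneg Re_less_1 Im_pos by (simp add: shoulder_height_def apex_height_def)
  moreover have "apex_height - shoulder_height < Im \<omega>"
    using shoulder_add_apex_height shoulder_height_pos by linarith
  ultimately have "0 < of_int j * Im \<omega>" "of_int j * Im \<omega> < 1 * Im \<omega>"
    by simp_all
  then show False
    using Im_pos by (simp only: mult_less_cancel_right zero_less_mult_iff) auto
qed

lemma corner_strips_imp_in_voronoi:
  assumes strip: "\<And>k. k < half_count \<Longrightarrow> z \<in> strip (corner k + corner (Suc k))"
  shows "z \<in> voronoi \<tau>"
proof -
  have "Suc (half_count - 1) = half_count" "0 < half_count" "Re \<omega> \<noteq> 0 \<Longrightarrow> Suc 0 < half_count"
    by (auto simp: half_count_def)
  then have last: "z \<in> strip 1" and first: "z \<in> strip \<omega>"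
    and middle: "Re \<omega> \<noteq> 0 \<Longrightarrow> z \<in> strip (\<omega> - 1)"
    using strip[of "half_count - 1"] strip[of 0] strip[of "Suc 0"]
    by (simp_all add: corner_sums strip_uminus numeral_2_eq_2[symmetric])
  have "z \<in> strip (\<omega> - 1)"
  proof (cases "Re \<omega> = 0")
    case True
    then have "(\<omega> - 1) \<bullet> (\<omega> - 1) = \<omega> \<bullet> \<omega> + 1"
      by (simp add: inner_diff_left inner_diff_right)
    moreover have "z \<bullet> (\<omega> - 1) = z \<bullet> \<omega> - Re z"
      by (simp add: inner_diff_right)
    moreover have "2 * \<bar>Re z\<bar> \<le> 1" "2 * \<bar>z \<bullet> \<omega>\<bar> \<le> \<omega> \<bullet> \<omega>"
      using last first by (simp_all add: strip_def)
    ultimately have "2 * \<bar>z \<bullet> (\<omega> - 1)\<bar> \<le> (\<omega> - 1) \<bullet> (\<omega> - 1)"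
      by linarith
    then show ?thesis by (simp add: strip_def)
  qed (rule middle)
  with last first show ?thesis by (rule in_voronoi_if_strips)
qed

sublocale voronoi_polygon \<tau> half_count corner
proof
  show "half_count = 2 \<or> half_count = 3"
    by (simp add: half_count_def)
  show "corner (k + half_count) = - corner k" for k
    by (rule corner_simps)
  show "0 < Im (corner l * cnj (corner k))" if "k < l" "l < half_count" for k l
    using that by (rule corner_ccw)
  have "corner k + corner (Suc k) \<in> {\<omega>, \<omega> - 1, - 1}" if "k < half_count" for k
    using that corner_sums
    by (cases rule: less_half_count_cases)
      (auto simp: half_count_def numeral_2_eq_2 numeral_3_eq_3 split: if_splits)
  then show "corner k + corner (Suc k) \<in> Z_adjoin \<tau>" if "k < half_count" for k
    using that basis_in_Z_adjoin by fastforce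
  show "corner k \<in> voronoi \<tau>" if "k < half_count" for k
    using that by (rule corner_in_voronoi)
  show "z \<in> voronoi \<tau>" if "\<And>k. k < half_count \<Longrightarrow> z \<in> strip (corner k + corner (Suc k))" for z
    using that by (rule corner_strips_imp_in_voronoi)
  show "Re (corner 0) = 1/2" "corner (half_count - 1) = corner 0 - 1"
    using corner_sums(3) corner_simps(4)[of 0] by (simp_all add: corner_simps(1) algebra_simps)
  show "Re (corner k) < 1/2" if "0 < k" "k < half_count" for k
    using that(2,1) Re_less_1 by (cases rule: less_half_count_cases) (auto simp: corner_simps)
  show "0 < Im (corner k)" if "k < half_count" for k
    using that shoulder_le_apex_height shoulder_height_pos
    by (cases rule: less_half_count_cases) (auto simp: corner_simps)
  show "corner 1 - corner 2 \<notin> Z_adjoin \<tau>" if "half_count = 3"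
    using that corners_inequivalent by (auto simp: half_count_def split: if_splits)
qed

end

section \<open>Non-adjacent forms\<close>

lemma is_wNAF_iff:
  "is_wNAF w D \<xi> \<longleftrightarrow>
     (\<forall>j. \<xi> j \<in> D) \<and> (\<forall>i j. \<xi> i \<noteq> 0 \<longrightarrow> \<xi> j \<noteq> 0 \<longrightarrow> i < j \<longrightarrow> i + int w \<le> j)"
proof -
  have "finite {j \<in> {k..<k + int w}. \<xi> j \<noteq> 0}" for k
    by (rule finite_subset[of _ "{k..<k + int w}"]) auto
  then have "(\<forall>k. card {j \<in> {k..<k + int w}. \<xi> j \<noteq> 0} \<le> 1) \<longleftrightarrow>
    (\<forall>k. \<forall>i\<in>{k..<k + int w}. \<forall>j\<in>{k..<k + int w}. \<xi> i \<noteq> 0 \<longrightarrow> \<xi> j \<noteq> 0 \<longrightarrow> i = j)"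
    by (simp only: One_nat_def card_le_Suc0_iff_eq) blast
  also have "\<dots> \<longleftrightarrow> (\<forall>i j. \<xi> i \<noteq> 0 \<longrightarrow> \<xi> j \<noteq> 0 \<longrightarrow> i < j \<longrightarrow> i + int w \<le> j)" (is "?windows \<longleftrightarrow> ?separated")
  proof
    assume windows: ?windows
    show ?separated
    proof (intro allI impI leI notI)
      fix i j assume "\<xi> i \<noteq> 0" "\<xi> j \<noteq> 0" "i < j" "j < i + int w"
      with windows[rule_format, of i i j] show False by simp
    qed
  next
    assume separated: ?separated
    show ?windows
    proof (intro allI ballI impI)
      fix k i j
      assume "i \<in> {k..<k + int w}" "j \<in> {k..<k + int w}" "\<xi> i \<noteq> 0" "\<xi> j \<noteq> 0"
      with separated[rule_format, of i j] separated[rule_format, of j i] show "i = j" by fastforce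
    qed
  qed
  finally show ?thesis by (simp add: is_wNAF_def)
qed

lemma wNAF_fin0_eventually_zero:
  assumes "\<xi> \<in> wNAF_fin0 w D"
  obtains N where "\<And>k. k \<ge> N \<Longrightarrow> \<xi> (int k) = 0"
proof -
  have "finite {j. \<xi> j \<noteq> 0}" using assms by (simp add: wNAF_fin0_def)
  then obtain M where "\<And>j. \<xi> j \<noteq> 0 \<Longrightarrow> j \<le> M"
    by (metis (mono_tags) Max_ge mem_Collect_eq)
  then show thesis
    by (intro that[of "nat (M + 1)"]) force
qed

lemma naf_value_eq_sum:
  assumes "\<And>j. j < 0 \<Longrightarrow> \<xi> j = 0" "\<And>k. k \<ge> n \<Longrightarrow> \<xi> (int k) = 0"
  shows "naf_value \<tau> \<xi> = (\<Sum>k<n. \<xi> (int k) * \<tau> ^ k)"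
proof -
  have "naf_value \<tau> \<xi> = (\<Sum>\<^sub>\<infinity>j\<in>int ` {..<n}. \<xi> j * \<tau> powi j)"
    unfolding naf_value_def
  proof (rule infsum_cong_neutral)
    fix j assume "j \<in> UNIV - int ` {..<n}"
    then have "j < 0 \<or> (\<exists>k\<ge>n. j = int k)"
      by (metis DiffD2 image_eqI lessThan_iff nonneg_int_cases not_le)
    then show "\<xi> j * \<tau> powi j = 0" using assms by auto
  qed auto
  also have "\<dots> = (\<Sum>k<n. \<xi> (int k) * \<tau> ^ k)"
    by (simp add: sum.reindex)
  finally show ?thesis .
qed

definition naf_drop :: "nat \<Rightarrow> (int \<Rightarrow> complex) \<Rightarrow> int \<Rightarrow> complex" where
  "naf_drop n \<xi> j = (if j < 0 then 0 else \<xi> (j + int n))"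

lemma naf_drop_1_drop: "naf_drop 1 (naf_drop n \<xi>) = naf_drop (Suc n) \<xi>"
  by (auto simp: naf_drop_def fun_eq_iff algebra_simps)

lemma naf_drop_in_wNAF_fin0:
  assumes "\<xi> \<in> wNAF_fin0 w D"
  shows "naf_drop n \<xi> \<in> wNAF_fin0 w D"
proof -
  have \<xi>: "\<xi> j \<in> D" "\<xi> i \<noteq> 0 \<Longrightarrow> \<xi> j \<noteq> 0 \<Longrightarrow> i < j \<Longrightarrow> i + int w \<le> j"
    and neg: "j < 0 \<Longrightarrow> \<xi> j = 0" and fin: "finite {j. \<xi> j \<noteq> 0}" for i j
    using assms by (auto simp: wNAF_fin0_def is_wNAF_iff)
  have "0 \<in> D" using \<xi>(1)[of "-1"] neg[of "-1"] by simp
  moreover have "{j. naf_drop n \<xi> j \<noteq> 0} \<subseteq> (\<lambda>j. j - int n) ` {j. \<xi> j \<noteq> 0}"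
    by (auto simp: naf_drop_def image_iff intro!: exI[of _ "j + int n" for j])
  with fin have "finite {j. naf_drop n \<xi> j \<noteq> 0}"
    by (meson finite_imageI finite_subset)
  moreover have "i + int w \<le> j" if "naf_drop n \<xi> i \<noteq> 0" "naf_drop n \<xi> j \<noteq> 0" "i < j" for i j
    using \<xi>(2)[of "i + int n" "j + int n"] that by (auto simp: naf_drop_def split: if_splits)
  ultimately show ?thesis
    using \<xi>(1) by (auto simp: wNAF_fin0_def is_wNAF_iff) (simp_all add: naf_drop_def)
qed

lemma naf_value_drop:
  assumes "\<xi> \<in> wNAF_fin0 w D"
  shows "naf_value \<tau> \<xi> = (\<Sum>k<n. \<xi> (int k) * \<tau> ^ k) + \<tau> ^ n * naf_value \<tau> (naf_drop n \<xi>)"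
proof -
  obtain N where vanishing: "\<And>k. k \<ge> N \<Longrightarrow> \<xi> (int k) = 0"
    using wNAF_fin0_eventually_zero[OF assms] by blast
  have "naf_value \<tau> \<xi> = (\<Sum>k<n + N. \<xi> (int k) * \<tau> ^ k)"
    using assms vanishing by (intro naf_value_eq_sum) (auto simp: wNAF_fin0_def)
  also have "\<dots> = (\<Sum>k<n. \<xi> (int k) * \<tau> ^ k) + (\<Sum>k<N. \<xi> (int (n + k)) * \<tau> ^ (n + k))"
    by (induction N) (simp_all add: add.assoc)
  also have "(\<Sum>k<N. \<xi> (int (n + k)) * \<tau> ^ (n + k)) = \<tau> ^ n * (\<Sum>k<N. naf_drop n \<xi> (int k) * \<tau> ^ k)"
    by (simp add: naf_drop_def sum_distrib_left power_add mult_ac add_ac)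
  also have "(\<Sum>k<N. naf_drop n \<xi> (int k) * \<tau> ^ k) = naf_value \<tau> (naf_drop n \<xi>)"
    using vanishing[of "k + n" for k] by (intro naf_value_eq_sum[symmetric]) (auto simp: naf_drop_def)
  finally show ?thesis .
qed

definition naf_step :: "complex \<Rightarrow> nat \<Rightarrow> complex \<Rightarrow> complex" where
  "naf_step \<tau> w y = (y - next_digit \<tau> w y) / \<tau>"

definition naf_digit :: "complex \<Rightarrow> nat \<Rightarrow> complex \<Rightarrow> nat \<Rightarrow> complex" where
  "naf_digit \<tau> w z k = next_digit \<tau> w ((naf_step \<tau> w ^^ k) z)"

definition naf_seq :: "complex \<Rightarrow> nat \<Rightarrow> complex \<Rightarrow> int \<Rightarrow> complex" where
  "naf_seq \<tau> w z j = (if j < 0 then 0 else naf_digit \<tau> w z (nat j))"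

definition naf_terminates :: "complex \<Rightarrow> nat \<Rightarrow> complex \<Rightarrow> bool" where
  "naf_terminates \<tau> w z \<longleftrightarrow> (\<exists>n. (naf_step \<tau> w ^^ n) z = 0)"

lemma naf_steps_add: "(naf_step \<tau> w ^^ (m + n)) z = (naf_step \<tau> w ^^ m) ((naf_step \<tau> w ^^ n) z)"
  by (simp add: funpow_add)

lemma naf_terminates_steps: "naf_terminates \<tau> w ((naf_step \<tau> w ^^ k) z) \<Longrightarrow> naf_terminates \<tau> w z"
  unfolding naf_terminates_def by (metis naf_steps_add)

lemma next_digit_if_dvd: "Z_dvd \<tau> \<tau> y \<Longrightarrow> next_digit \<tau> w y = 0"
  by (simp add: next_digit_def)

lemma naf_steps_0: "(naf_step \<tau> w ^^ k) 0 = 0"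
  by (induction k) (simp_all add: naf_step_def next_digit_if_dvd)

lemma naf_digit_eq_0:
  assumes "(naf_step \<tau> w ^^ n) z = 0" "n \<le> k"
  shows "naf_digit \<tau> w z k = 0"
  using naf_steps_add[where m = "k - n" and n = n] assms
  by (simp add: naf_digit_def naf_steps_0 next_digit_if_dvd)

lemma naf_loop_iterate:
  "((\<lambda>(\<xi>, l, y). (\<xi>(l := next_digit \<tau> w y), Suc l, (y - next_digit \<tau> w y) / \<tau>)) ^^ k) (\<xi>, 0, z) =
     (\<lambda>i. if i < k then naf_digit \<tau> w z i else \<xi> i, k, (naf_step \<tau> w ^^ k) z)"
proof (induction k)
  case (Suc k)
  then show ?case
    using naf_step_def[of \<tau> w "(naf_step \<tau> w ^^ k) z"]
    by (simp add: fun_eq_iff less_Suc_eq naf_digit_def)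
qed simp

lemma naf_algorithm_eq_Some:
  assumes "naf_terminates \<tau> w z"
  obtains n where "(naf_step \<tau> w ^^ n) z = 0"
    "naf_algorithm \<tau> w z = Some (rev (map (naf_digit \<tau> w z) [0..<n]))"
proof -
  define n where "n = (LEAST n. (naf_step \<tau> w ^^ n) z = 0)"
  have "(naf_step \<tau> w ^^ n) z = 0"
    unfolding n_def using assms by (rule LeastI_ex[OF naf_terminates_def[THEN iffD1]])
  moreover have "naf_algorithm \<tau> w z = Some (rev (map (naf_digit \<tau> w z) [0..<n]))"
    using assms
    by (auto simp: naf_algorithm_def while_option_def naf_loop_iterate naf_terminates_def n_def)
  ultimately show thesis by (rule that)
qed

lemma naf_algorithm_output:
  assumes "naf_terminates \<tau> w z"
  obtains ds where "naf_algorithm \<tau> w z = Some ds" "word_seq ds = naf_seq \<tau> w z"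
proof -
  obtain n where halted: "(naf_step \<tau> w ^^ n) z = 0"
    and out: "naf_algorithm \<tau> w z = Some (rev (map (naf_digit \<tau> w z) [0..<n]))"
    using naf_algorithm_eq_Some[OF assms] by blast
  have "word_seq (rev (map (naf_digit \<tau> w z) [0..<n])) = naf_seq \<tau> w z"
    using naf_digit_eq_0[OF halted] by (auto simp: word_seq_def naf_seq_def fun_eq_iff)
  with out show thesis by (rule that)
qed

locale restricted_tiling =
  fixes \<tau> :: complex and w :: nat
  assumes tau_nonzero: "\<tau> \<noteq> 0" and w_pos: "0 < w"
    and tiling: "\<exists>!u. u \<in> Z_adjoin \<tau> \<and> z - u \<in> restricted_voronoi \<tau>"
begin

definition cell_representative :: "complex \<Rightarrow> complex \<Rightarrow> bool" where
  "cell_representative y d \<longleftrightarrow>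
     d \<in> Z_adjoin \<tau> \<and> Z_cong \<tau> w d y \<and> d / \<tau> ^ w \<in> restricted_voronoi \<tau>"

lemma ex1_cell_representative:
  assumes "y \<in> Z_adjoin \<tau>"
  shows "\<exists>!d. cell_representative y d"
proof -
  obtain u where u: "u \<in> Z_adjoin \<tau>" "y / \<tau> ^ w - u \<in> restricted_voronoi \<tau>"
    and unique: "\<And>x. x \<in> Z_adjoin \<tau> \<Longrightarrow> y / \<tau> ^ w - x \<in> restricted_voronoi \<tau> \<Longrightarrow> x = u"
    using tiling[of "y / \<tau> ^ w"] by blast
  show ?thesis
  proof (rule ex1I[of _ "y + \<tau> ^ w * - u"])
    have "Z_cong \<tau> w (y + \<tau> ^ w * - u) y"
      unfolding Z_cong_iff using u(1) by blast
    moreover have "(y + \<tau> ^ w * - u) / \<tau> ^ w = y / \<tau> ^ w - u"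
      using tau_nonzero by (simp add: diff_divide_distrib)
    ultimately show "cell_representative y (y + \<tau> ^ w * - u)"
      using u assms by (auto simp: cell_representative_def)
    fix d assume d: "cell_representative y d"
    then obtain c where c: "c \<in> Z_adjoin \<tau>" "d = y + \<tau> ^ w * c"
      unfolding cell_representative_def Z_cong_iff by blast
    then have "- c = u"
      using d tau_nonzero by (intro unique) (auto simp: cell_representative_def add_divide_distrib)
    then show "d = y + \<tau> ^ w * - u" using c by auto
  qed
qed

lemma the_elem_representatives:
  assumes "x \<in> Z_adjoin \<tau>"
  shows "d = the_elem (residue_class \<tau> w x \<inter> (\<lambda>z. \<tau> ^ w * z) ` restricted_voronoi \<tau>) \<longleftrightarrow>
    cell_representative x d"
proof -
  have "residue_class \<tau> w x \<inter> (\<lambda>z. \<tau> ^ w * z) ` restricted_voronoi \<tau> = Collect (cell_representative x)"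
    using tau_nonzero
    by (auto simp: cell_representative_def residue_class_def
        intro!: image_eqI[of d _ "d / \<tau> ^ w" for d])
  moreover obtain e where unique: "cell_representative x d \<longleftrightarrow> d = e" for d
    using ex1_cell_representative[OF assms] by metis
  then have "Collect (cell_representative x) = {e}" by auto
  ultimately show ?thesis by (auto simp: unique)
qed

lemma in_digits_iff:
  "d \<in> digits \<tau> w \<longleftrightarrow> d = 0 \<or> d \<in> Z_adjoin \<tau> \<and> \<not> Z_dvd \<tau> \<tau> d \<and> d / \<tau> ^ w \<in> restricted_voronoi \<tau>"
proof -
  have "d \<in> digits \<tau> w \<longleftrightarrow> d = 0 \<or> (\<exists>x\<in>Z_adjoin \<tau>. \<not> Z_dvd \<tau> \<tau> x \<and> cell_representative x d)"
    using the_elem_representatives by (auto simp: digits_def)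
  then show ?thesis
    using Z_cong_imp_dvd_iff[of \<tau> w d] w_pos Z_cong_refl[of \<tau> w d]
    unfolding cell_representative_def by metis
qed

lemma digit_in_Z_adjoin: "d \<in> digits \<tau> w \<Longrightarrow> d \<in> Z_adjoin \<tau>"
  by (auto simp: in_digits_iff)

lemma ex1_digit:
  assumes "y \<in> Z_adjoin \<tau>" "\<not> Z_dvd \<tau> \<tau> y"
  shows "\<exists>!d. d \<in> digits \<tau> w \<and> Z_cong \<tau> w d y"
proof -
  have "d \<in> digits \<tau> w \<and> Z_cong \<tau> w d y \<longleftrightarrow> cell_representative y d" for d
    using assms Z_cong_imp_dvd_iff[of \<tau> w d y] w_pos
    by (auto simp: in_digits_iff cell_representative_def)
  then show ?thesis using ex1_cell_representative[OF assms(1)] by simp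
qed

lemma next_digit_not_dvd:
  assumes "y \<in> Z_adjoin \<tau>" "\<not> Z_dvd \<tau> \<tau> y"
  shows "next_digit \<tau> w y \<in> digits \<tau> w" "Z_cong \<tau> w (next_digit \<tau> w y) y"
  using theI'[OF ex1_digit[OF assms]] assms(2) by (auto simp: next_digit_def)

lemma next_digit_eqI:
  assumes "y \<in> Z_adjoin \<tau>" "d \<in> digits \<tau> w" "d \<noteq> 0" "Z_cong \<tau> w d y"
  shows "next_digit \<tau> w y = d"
proof -
  have "\<not> Z_dvd \<tau> \<tau> y"
    using assms Z_cong_imp_dvd_iff[OF assms(4)] w_pos by (auto simp: in_digits_iff)
  then show ?thesis
    using ex1_digit next_digit_not_dvd assms by blast
qed

lemma next_digit_in_digits: "y \<in> Z_adjoin \<tau> \<Longrightarrow> next_digit \<tau> w y \<in> digits \<tau> w"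
  using next_digit_not_dvd(1) by (cases "Z_dvd \<tau> \<tau> y") (simp_all add: next_digit_if_dvd in_digits_iff)

lemma naf_step_in_Z_adjoin:
  assumes "y \<in> Z_adjoin \<tau>"
  shows "naf_step \<tau> w y \<in> Z_adjoin \<tau>"
proof -
  have "Z_dvd \<tau> \<tau> (y - next_digit \<tau> w y)"
  proof (cases "Z_dvd \<tau> \<tau> y")
    case False
    then obtain c where "c \<in> Z_adjoin \<tau>" "next_digit \<tau> w y = y + \<tau> ^ w * c"
      using next_digit_not_dvd(2)[OF assms] by (auto simp: Z_cong_iff)
    then have "y - next_digit \<tau> w y = \<tau> * (\<tau> ^ (w - 1) * - c)"
      using w_pos by (simp add: power_eq_if)
    moreover have "\<tau> ^ (w - 1) * - c \<in> Z_adjoin \<tau>"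
      using \<open>c \<in> Z_adjoin \<tau>\<close> by blast
    ultimately show ?thesis by (simp only: Z_dvd_mult_self)
  qed (simp add: next_digit_if_dvd)
  then show ?thesis
    using tau_nonzero by (auto simp: naf_step_def Z_dvd_def)
qed

lemma naf_steps_in_Z_adjoin: "y \<in> Z_adjoin \<tau> \<Longrightarrow> (naf_step \<tau> w ^^ k) y \<in> Z_adjoin \<tau>"
  by (induction k) (auto intro: naf_step_in_Z_adjoin)

lemma naf_step_mult: "c \<in> Z_adjoin \<tau> \<Longrightarrow> naf_step \<tau> w (\<tau> * c) = c"
  using tau_nonzero by (simp add: naf_step_def next_digit_if_dvd Z_dvd_mult_self)

lemma naf_steps_power_mult: "c \<in> Z_adjoin \<tau> \<Longrightarrow> (naf_step \<tau> w ^^ n) (\<tau> ^ n * c) = c"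
proof (induction n)
  case (Suc n)
  have "naf_step \<tau> w (\<tau> ^ Suc n * c) = \<tau> ^ n * c"
    using naf_step_mult[of "\<tau> ^ n * c"] Suc.prems by (auto simp: mult.assoc)
  then show ?case using Suc by (simp add: funpow_Suc_right del: funpow.simps power_Suc)
qed simp

lemma naf_steps_not_dvd:
  assumes "y \<in> Z_adjoin \<tau>" "\<not> Z_dvd \<tau> \<tau> y"
  obtains c where "c \<in> Z_adjoin \<tau>" "y = next_digit \<tau> w y + \<tau> ^ w * c"
    "\<And>k. 0 < k \<Longrightarrow> k \<le> w \<Longrightarrow> (naf_step \<tau> w ^^ k) y = \<tau> ^ (w - k) * c"
proof -
  obtain c' where c': "c' \<in> Z_adjoin \<tau>" "next_digit \<tau> w y = y + \<tau> ^ w * c'"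
    using next_digit_not_dvd(2)[OF assms] unfolding Z_cong_iff by blast
  define c where "c = - c'"
  have c: "c \<in> Z_adjoin \<tau>" "y = next_digit \<tau> w y + \<tau> ^ w * c"
    using c' by (auto simp: c_def)
  have "(naf_step \<tau> w ^^ k) y = \<tau> ^ (w - k) * c" if "0 < k" "k \<le> w" for k
  proof -
    obtain j where j: "k = Suc j" using \<open>0 < k\<close> gr0_implies_Suc by blast
    then have "w = Suc (j + (w - k))" using that by simp
    have "y - next_digit \<tau> w y = \<tau> ^ w * c"
      using c(2) by (metis add_diff_cancel_left')
    also have "\<dots> = \<tau> * (\<tau> ^ j * (\<tau> ^ (w - k) * c))"
      by (subst \<open>w = _\<close>) (simp add: power_add mult_ac)
    finally have "naf_step \<tau> w y = \<tau> ^ j * (\<tau> ^ (w - k) * c)"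
      using tau_nonzero by (simp add: naf_step_def)
    then show ?thesis
      using naf_steps_power_mult[of "\<tau> ^ (w - k) * c" j] c(1)
      by (auto simp: j funpow_Suc_right simp del: funpow.simps)
  qed
  with c show thesis by (rule that)
qed

lemma naf_digit_after_nonzero:
  assumes "z \<in> Z_adjoin \<tau>" "naf_digit \<tau> w z i \<noteq> 0" "i < j" "j < i + w"
  shows "naf_digit \<tau> w z j = 0"
proof -
  define y where "y = (naf_step \<tau> w ^^ i) z"
  have "\<not> Z_dvd \<tau> \<tau> y"
    using assms(2) next_digit_if_dvd by (auto simp: naf_digit_def y_def)
  then obtain c where c: "c \<in> Z_adjoin \<tau>"
    "\<And>k. 0 < k \<Longrightarrow> k \<le> w \<Longrightarrow> (naf_step \<tau> w ^^ k) y = \<tau> ^ (w - k) * c"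
    using naf_steps_not_dvd[of y] naf_steps_in_Z_adjoin[OF assms(1)] by (metis y_def)
  have "(naf_step \<tau> w ^^ j) z = (naf_step \<tau> w ^^ (j - i)) y"
    using naf_steps_add[where m = "j - i" and n = i] assms(3) by (simp add: y_def)
  also have "\<dots> = \<tau> ^ (w - (j - i)) * c"
    using assms by (intro c(2)) auto
  also have "\<dots> = \<tau> * (\<tau> ^ (w - (j - i) - 1) * c)"
    using assms by (simp add: power_eq_if)
  finally show ?thesis
    using c(1) unfolding naf_digit_def by (auto intro!: next_digit_if_dvd Z_dvd_mult_self)
qed

lemma naf_seq_in_wNAF_fin0:
  assumes z: "z \<in> Z_adjoin \<tau>" "naf_terminates \<tau> w z"
  shows "naf_seq \<tau> w z \<in> wNAF_fin0 w (digits \<tau> w)"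
proof -
  obtain n where halted: "(naf_step \<tau> w ^^ n) z = 0" using z(2) by (auto simp: naf_terminates_def)
  have "i + int w \<le> j" if "naf_seq \<tau> w z i \<noteq> 0" "naf_seq \<tau> w z j \<noteq> 0" "i < j" for i j
    using naf_digit_after_nonzero[OF z(1), of "nat i" "nat j"] that
    by (force simp: naf_seq_def split: if_splits)
  moreover have "naf_seq \<tau> w z j \<in> digits \<tau> w" for j
    using next_digit_in_digits naf_steps_in_Z_adjoin[OF z(1)]
    by (simp add: naf_seq_def naf_digit_def in_digits_iff[of 0])
  moreover have "naf_seq \<tau> w z j = 0" if "j \<notin> {0..<int n}" for j
    using that naf_digit_eq_0[OF halted, of "nat j"] by (auto simp: naf_seq_def)
  then have "{j. naf_seq \<tau> w z j \<noteq> 0} \<subseteq> {0..<int n}" by blast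
  then have "finite {j. naf_seq \<tau> w z j \<noteq> 0}"
    by (rule finite_subset) simp
  ultimately show ?thesis
    by (simp add: wNAF_fin0_def is_wNAF_iff) (simp add: naf_seq_def)
qed

lemma sum_naf_digits:
  "z = (\<Sum>k<n. naf_digit \<tau> w z k * \<tau> ^ k) + \<tau> ^ n * (naf_step \<tau> w ^^ n) z"
proof (induction n)
  case (Suc n)
  have "(naf_step \<tau> w ^^ n) z = naf_digit \<tau> w z n + \<tau> * (naf_step \<tau> w ^^ Suc n) z"
    using tau_nonzero by (simp add: naf_digit_def naf_step_def)
  then have "\<tau> ^ n * (naf_step \<tau> w ^^ n) z =
      \<tau> ^ n * (naf_digit \<tau> w z n + \<tau> * (naf_step \<tau> w ^^ Suc n) z)"
    by (rule arg_cong)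
  also have "\<dots> = naf_digit \<tau> w z n * \<tau> ^ n + \<tau> ^ Suc n * (naf_step \<tau> w ^^ Suc n) z"
    by (simp add: algebra_simps)
  finally have "\<tau> ^ n * (naf_step \<tau> w ^^ n) z =
      naf_digit \<tau> w z n * \<tau> ^ n + \<tau> ^ Suc n * (naf_step \<tau> w ^^ Suc n) z" .
  then show ?case
    using Suc by (simp only: sum.lessThan_Suc add.assoc)
qed simp

lemma naf_value_naf_seq:
  assumes "naf_terminates \<tau> w z"
  shows "naf_value \<tau> (naf_seq \<tau> w z) = z"
proof -
  obtain n where halted: "(naf_step \<tau> w ^^ n) z = 0" using assms by (auto simp: naf_terminates_def)
  have "naf_value \<tau> (naf_seq \<tau> w z) = (\<Sum>k<n. naf_seq \<tau> w z (int k) * \<tau> ^ k)"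
    using naf_digit_eq_0[OF halted] by (intro naf_value_eq_sum) (auto simp: naf_seq_def)
  also have "\<dots> = z"
    using sum_naf_digits[of z n] halted by (simp add: naf_seq_def)
  finally show ?thesis .
qed

lemma naf_value_in_Z_adjoin:
  assumes "\<xi> \<in> wNAF_fin0 w (digits \<tau> w)"
  shows "naf_value \<tau> \<xi> \<in> Z_adjoin \<tau>"
proof -
  obtain N where "\<And>k. k \<ge> N \<Longrightarrow> \<xi> (int k) = 0"
    using wNAF_fin0_eventually_zero[OF assms] by blast
  moreover have "\<xi> j \<in> digits \<tau> w" "j < 0 \<Longrightarrow> \<xi> j = 0" for j
    using assms by (auto simp: wNAF_fin0_def is_wNAF_def)
  ultimately show ?thesis
    using digit_in_Z_adjoin by (simp add: naf_value_eq_sum[of \<xi> N]) blast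
qed

lemma next_digit_naf_value:
  assumes \<xi>: "\<xi> \<in> wNAF_fin0 w (digits \<tau> w)"
  shows "next_digit \<tau> w (naf_value \<tau> \<xi>) = \<xi> 0"
proof (cases "\<xi> 0 = 0")
  case True
  then have "naf_value \<tau> \<xi> = \<tau> * naf_value \<tau> (naf_drop 1 \<xi>)"
    using naf_value_drop[OF \<xi>, of \<tau> 1] by simp
  then have "Z_dvd \<tau> \<tau> (naf_value \<tau> \<xi>)"
    using Z_dvd_mult_self naf_value_in_Z_adjoin naf_drop_in_wNAF_fin0[OF \<xi>] by metis
  with True show ?thesis by (simp add: next_digit_if_dvd)
next
  case False
  have digit: "\<xi> 0 \<in> digits \<tau> w" and sep: "\<xi> j \<noteq> 0 \<Longrightarrow> 0 < j \<Longrightarrow> int w \<le> j" for j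
    using \<xi> False by (auto simp: wNAF_fin0_def is_wNAF_iff)
  have "\<xi> (int k) = 0" if "k \<in> {..<w} - {0}" for k
    using sep[of "int k"] that by force
  then have "(\<Sum>k<w. \<xi> (int k) * \<tau> ^ k) = (\<Sum>k\<in>{0}. \<xi> (int k) * \<tau> ^ k)"
    using w_pos by (intro sum.mono_neutral_right) auto
  then have "naf_value \<tau> \<xi> = \<xi> 0 + \<tau> ^ w * naf_value \<tau> (naf_drop w \<xi>)"
    using naf_value_drop[OF \<xi>, of \<tau> w] by simp
  then have "\<xi> 0 = naf_value \<tau> \<xi> + \<tau> ^ w * - naf_value \<tau> (naf_drop w \<xi>)"
    by simp
  then have "Z_cong \<tau> w (\<xi> 0) (naf_value \<tau> \<xi>)"
    unfolding Z_cong_iff using naf_value_in_Z_adjoin[OF naf_drop_in_wNAF_fin0[OF \<xi>]] by blast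
  with digit False show ?thesis
    using naf_value_in_Z_adjoin[OF \<xi>] by (intro next_digit_eqI)
qed

lemma naf_step_naf_value:
  assumes "\<xi> \<in> wNAF_fin0 w (digits \<tau> w)"
  shows "naf_step \<tau> w (naf_value \<tau> \<xi>) = naf_value \<tau> (naf_drop 1 \<xi>)"
  unfolding naf_step_def next_digit_naf_value[OF assms]
  using naf_value_drop[OF assms, of \<tau> 1] tau_nonzero by simp

lemma naf_steps_naf_value:
  assumes "\<xi> \<in> wNAF_fin0 w (digits \<tau> w)"
  shows "(naf_step \<tau> w ^^ n) (naf_value \<tau> \<xi>) = naf_value \<tau> (naf_drop n \<xi>)"
proof (induction n)
  case 0
  have "naf_drop 0 \<xi> = \<xi>" using assms by (auto simp: naf_drop_def wNAF_fin0_def)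
  then show ?case by simp
next
  case (Suc n)
  then show ?case
    using naf_step_naf_value[OF naf_drop_in_wNAF_fin0[OF assms, of n]]
    by (simp add: naf_drop_1_drop del: One_nat_def)
qed

lemma wNAF_eq_naf_seq:
  assumes "\<xi> \<in> wNAF_fin0 w (digits \<tau> w)"
  shows "\<xi> = naf_seq \<tau> w (naf_value \<tau> \<xi>)"
proof
  fix j
  have "naf_digit \<tau> w (naf_value \<tau> \<xi>) k = \<xi> (int k)" for k
    using next_digit_naf_value[OF naf_drop_in_wNAF_fin0[OF assms, of k]]
    by (simp add: naf_digit_def naf_steps_naf_value[OF assms] naf_drop_def)
  then show "\<xi> j = naf_seq \<tau> w (naf_value \<tau> \<xi>) j"
    using assms by (auto simp: naf_seq_def wNAF_fin0_def)
qed

lemma ex1_wNAF: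
  assumes "z \<in> Z_adjoin \<tau>" "naf_terminates \<tau> w z"
  shows "\<exists>!\<xi>. \<xi> \<in> wNAF_fin0 w (digits \<tau> w) \<and> naf_value \<tau> \<xi> = z"
  using naf_seq_in_wNAF_fin0 naf_value_naf_seq wNAF_eq_naf_seq assms by metis

end

section \<open>Imaginary quadratic orders\<close>

locale imaginary_quadratic =
  fixes p q :: int and \<tau> :: complex
  assumes disc: "4 * q - p ^ 2 > 0"
    and root: "\<tau> ^ 2 - of_int p * \<tau> + of_int q = 0"
begin

lemma tau_sq: "\<tau>\<^sup>2 = of_int p * \<tau> - of_int q"
  using root by (simp add: algebra_simps)

lemma Re_Im_root:
  "(Re \<tau>)\<^sup>2 - (Im \<tau>)\<^sup>2 - of_int p * Re \<tau> + of_int q = 0" "(2 * Re \<tau> - of_int p) * Im \<tau> = 0"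
  using arg_cong[OF root, of Re] arg_cong[OF root, of Im]
  by (simp_all add: power2_eq_square algebra_simps)

lemma Im_tau_nonzero: "Im \<tau> \<noteq> 0"
proof
  assume "Im \<tau> = 0"
  with Re_Im_root(1) have "(2 * Re \<tau> - of_int p)\<^sup>2 = - of_int (4 * q - p\<^sup>2)"
    by (simp add: power2_eq_square algebra_simps)
  moreover have "real_of_int (4 * q - p\<^sup>2) > 0"
    using disc by (simp only: of_int_0_less_iff)
  ultimately show False
    using zero_le_power2[of "2 * Re \<tau> - of_int p"] by linarith
qed

lemma Re_tau: "Re \<tau> = of_int p / 2"
  using Re_Im_root(2) Im_tau_nonzero by simp

lemma Im_tau_sq: "(Im \<tau>)\<^sup>2 = of_int (4 * q - p\<^sup>2) / 4"
  using Re_Im_root(1) by (simp add: Re_tau power2_eq_square field_simps)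

lemma cmod_sq: "(cmod (of_int a + of_int b * \<tau>))\<^sup>2 = of_int (a\<^sup>2 + a * b * p + b\<^sup>2 * q)"
proof -
  have "(cmod (of_int a + of_int b * \<tau>))\<^sup>2 =
      (of_int a + of_int b * of_int p / 2)\<^sup>2 + (of_int b)\<^sup>2 * (Im \<tau>)\<^sup>2"
    by (simp add: cmod_power2 Re_tau power_mult_distrib)
  then show ?thesis
    unfolding Im_tau_sq by (simp add: power2_eq_square field_simps)
qed

lemma in_Z_adjoin_iff: "z \<in> Z_adjoin \<tau> \<longleftrightarrow> (\<exists>a b :: int. z = of_int a + of_int b * \<tau>)"
proof
  assume "z \<in> Z_adjoin \<tau>"
  then obtain f :: "int poly" where "z = poly (map_poly of_int f) \<tau>"
    by (auto simp: Z_adjoin_def)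
  then show "\<exists>a b :: int. z = of_int a + of_int b * \<tau>"
  proof (induction f arbitrary: z)
    case 0
    then show ?case by (auto intro!: exI[of _ 0])
  next
    case (pCons c f)
    obtain a b :: int where ab: "poly (map_poly of_int f) \<tau> = of_int a + of_int b * \<tau>"
      using pCons.IH by blast
    have "z = of_int c + \<tau> * (of_int a + of_int b * \<tau>)"
      using pCons.prems pCons.hyps by (simp add: map_poly_pCons ab)
    also have "\<dots> = of_int c + of_int a * \<tau> + of_int b * \<tau>\<^sup>2"
      by (simp add: algebra_simps power2_eq_square)
    also have "\<dots> = of_int (c - b * q) + of_int (a + b * p) * \<tau>"
      by (simp add: tau_sq algebra_simps)
    finally show ?case by blast
  qed
qed (auto intro!: Z_adjoin_add Z_adjoin_mult)

lemma Z_adjoin_cmod_ge_1: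
  assumes "z \<in> Z_adjoin \<tau>" "z \<noteq> 0"
  shows "1 \<le> cmod z"
proof -
  obtain k :: int where "(cmod z)\<^sup>2 = of_int k"
    using assms(1) cmod_sq unfolding in_Z_adjoin_iff by metis
  moreover have "0 < (cmod z)\<^sup>2" using assms(2) by simp
  ultimately have "1 \<le> (cmod z)\<^sup>2" by simp
  then show ?thesis using power2_le_imp_le[of 1 "cmod z"] by simp
qed

lemma closed_subset_Z_adjoin:
  assumes "S \<subseteq> Z_adjoin \<tau>"
  shows "closed S"
proof (rule discrete_imp_closed[of 1])
  show "\<forall>x\<in>S. \<forall>y\<in>S. dist y x < 1 \<longrightarrow> y = x"
  proof (intro ballI impI)
    fix x y assume "x \<in> S" "y \<in> S" and close: "dist y x < 1"
    then have "y - x \<in> Z_adjoin \<tau>" using assms by blast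
    then show "y = x" using Z_adjoin_cmod_ge_1[of "y - x"] close by (auto simp: dist_norm)
  qed
qed simp

definition reduced_generator :: complex where
  "reduced_generator = Complex (of_int (p mod 2) / 2) \<bar>Im \<tau>\<bar>"

lemma tau_eq_reduced_generator:
  obtains l s :: int where "s * s = 1" "\<tau> = of_int l + of_int s * reduced_generator"
proof -
  have p: "real_of_int p = 2 * of_int (p div 2) + of_int (p mod 2)"
    by (metis div_mult_mod_eq mult.commute of_int_add of_int_mult of_int_numeral)
  show thesis
  proof (cases "Im \<tau> < 0")
    case True
    then show thesis
      using p by (intro that[of "-1" "p - p div 2"])
        (simp_all add: reduced_generator_def complex_eq_iff Re_tau)
  next
    case False
    then show thesis
      using p by (intro that[of 1 "p div 2"])
        (simp_all add: reduced_generator_def complex_eq_iff Re_tau)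
  qed
qed

lemma in_Z_adjoin_iff_generator:
  fixes l s :: int
  assumes "s * s = 1" and \<tau>: "\<tau> = of_int l + of_int s * \<omega>"
  shows "z \<in> Z_adjoin \<tau> \<longleftrightarrow> (\<exists>i j :: int. z = of_int i + of_int j * \<omega>)"
proof
  assume "z \<in> Z_adjoin \<tau>"
  then obtain a b :: int where "z = of_int a + of_int b * \<tau>"
    by (auto simp: in_Z_adjoin_iff)
  then have "z = of_int (a + b * l) + of_int (b * s) * \<omega>"
    by (simp add: \<tau> algebra_simps)
  then show "\<exists>i j :: int. z = of_int i + of_int j * \<omega>" by blast
next
  assume "\<exists>i j :: int. z = of_int i + of_int j * \<omega>"
  then obtain i j :: int where "z = of_int i + of_int j * \<omega>" by blast
  moreover have "of_int s * of_int s = (1 :: complex)"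
    using assms(1) by (metis of_int_1 of_int_mult)
  then have "\<omega> = of_int s * (\<tau> - of_int l)"
    by (simp add: \<tau> flip: mult.assoc)
  ultimately show "z \<in> Z_adjoin \<tau>" by blast
qed

sublocale lattice: reduced_lattice \<tau> reduced_generator
proof
  show "z \<in> Z_adjoin \<tau> \<longleftrightarrow> (\<exists>i j :: int. z = of_int i + of_int j * reduced_generator)" for z
    using tau_eq_reduced_generator in_Z_adjoin_iff_generator by metis
next
  show "0 < Im reduced_generator" "0 \<le> Re reduced_generator" "Re reduced_generator < 1"
    using Im_tau_nonzero by (simp_all add: reduced_generator_def)
  have "p mod 2 < 4 * q - p\<^sup>2"
  proof (cases "even p")
    case False
    then obtain k where "p = 2 * k + 1" by (elim oddE)
    then have "4 * q - p\<^sup>2 = 4 * (q - k\<^sup>2 - k) - 1"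
      by (simp add: power2_eq_square algebra_simps)
    moreover have "p mod 2 = 1" using False by (simp add: odd_iff_mod_2_eq_one)
    ultimately show ?thesis using disc by presburger
  qed (use disc in simp)
  then have "real_of_int (p mod 2) < of_int (4 * q - p\<^sup>2)"
    by (simp only: of_int_less_iff)
  then have "real_of_int (p mod 2) < 4 * (Im \<tau>)\<^sup>2"
    by (simp add: Im_tau_sq)
  moreover have "(real_of_int (p mod 2) / 2)\<^sup>2 = of_int (p mod 2) / 4"
    by (cases "even p") (simp_all add: odd_iff_mod_2_eq_one power2_eq_square)
  moreover have "(cmod reduced_generator)\<^sup>2 = (of_int (p mod 2) / 2)\<^sup>2 + (Im \<tau>)\<^sup>2"
    by (simp add: reduced_generator_def cmod_power2)
  ultimately show "Re reduced_generator < (cmod reduced_generator)\<^sup>2"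
    by (simp add: reduced_generator_def)
qed

lemma restricted_voronoi_tiling: "\<exists>!u. u \<in> Z_adjoin \<tau> \<and> z - u \<in> restricted_voronoi \<tau>"
  by (rule lattice.restricted_voronoi_tiling[OF closed_subset_Z_adjoin[OF subset_refl]])

lemma even_trace_if_twice_eq_tau_sq_mult:
  assumes q: "q = 2" and "y \<in> Z_adjoin \<tau>" "c \<in> Z_adjoin \<tau>" and not_dvd: "\<not> Z_dvd \<tau> \<tau> y"
    and "\<tau>\<^sup>2 * c = 2 * y"
  shows "even p"
proof (rule ccontr)
  assume "odd p"
  then obtain k where p: "p = 2 * k + 1" by (elim oddE)
  have "\<tau> \<noteq> 0" using Im_tau_nonzero by auto
  have two: "2 = \<tau> * (of_int p - \<tau>)"
    using tau_sq q by (simp add: algebra_simps power2_eq_square)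
  have "\<tau> * (\<tau> * c) = \<tau> * ((of_int p - \<tau>) * y)"
    using assms(5) two by (simp add: power2_eq_square mult.assoc)
  then have "\<tau> * c = (of_int p - \<tau>) * y" using \<open>\<tau> \<noteq> 0\<close> by simp
  then have p_y: "of_int p * y = \<tau> * (c + y)" by (simp add: algebra_simps)
  have "y = of_int p * y - of_int k * (2 * y)" by (simp add: p algebra_simps)
  also have "2 * y = \<tau> * ((of_int p - \<tau>) * y)" by (simp add: two mult.assoc)
  finally have "y = \<tau> * (c + y - of_int k * ((of_int p - \<tau>) * y))"
    unfolding p_y by (simp add: algebra_simps)
  moreover have "c + y - of_int k * ((of_int p - \<tau>) * y) \<in> Z_adjoin \<tau>"
    using assms(2,3) by blast
  ultimately show False using not_dvd Z_dvd_mult_self by metis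
qed

text \<open>Here \<open>2 / \<tau>\<^sup>2\<close> is a root of unity, one of whose powers is \<open>-1\<close>.\<close>

lemma tau_power_if_twice_eq_tau_sq_mult:
  assumes "q = 2" "y \<in> Z_adjoin \<tau>" "c \<in> Z_adjoin \<tau>" "\<not> Z_dvd \<tau> \<tau> y" "\<tau>\<^sup>2 * c = 2 * y"
  shows "\<tau>\<^sup>2 = - 2 \<or> (\<tau>\<^sup>2)\<^sup>2 = - 4"
proof -
  have "even p" by (rule even_trace_if_twice_eq_tau_sq_mult[OF assms])
  have "p\<^sup>2 < 3\<^sup>2" using disc assms(1) by simp
  then have "\<bar>p\<bar> < 3" using power2_less_imp_less[of "\<bar>p\<bar>" 3] by simp
  with \<open>even p\<close> have "p = 0 \<or> p = 2 \<or> p = -2" by presburger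
  then show ?thesis
  proof
    assume "p = 0"
    then show ?thesis using assms(1) by (simp add: tau_sq)
  next
    assume p: "p = 2 \<or> p = -2"
    have "(\<tau>\<^sup>2)\<^sup>2 = (of_int p * \<tau> - 2)\<^sup>2"
      by (simp add: tau_sq assms(1))
    also have "\<dots> = (of_int p)\<^sup>2 * \<tau>\<^sup>2 - 4 * of_int p * \<tau> + 4"
      by (simp add: power2_eq_square algebra_simps)
    also have "\<dots> = - 4"
      unfolding tau_sq using p assms(1) by auto
    finally show ?thesis by blast
  qed
qed

end

locale imaginary_quadratic_naf = imaginary_quadratic +
  fixes w :: nat
  assumes expanding: "cmod \<tau> > 1" and w_ge_2: "w \<ge> 2"
begin

sublocale restricted_tiling \<tau> w
  using expanding w_ge_2 restricted_voronoi_tiling by unfold_locales auto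

lemma cmod_tau_sq: "(cmod \<tau>)\<^sup>2 = of_int q"
  using cmod_sq[of 0 1] by simp

lemma cmod_tau_power_le_2:
  assumes "cmod \<tau> ^ w \<le> 2"
  shows "q = 2" "w = 2"
proof -
  have "1 < (cmod \<tau>)\<^sup>2" using expanding by simp
  moreover have "(cmod \<tau>)\<^sup>2 \<le> cmod \<tau> ^ w"
    using expanding w_ge_2 by (intro power_increasing) auto
  ultimately show "q = 2"
    using assms unfolding cmod_tau_sq by linarith
  show "w = 2"
  proof (rule ccontr)
    assume "w \<noteq> 2"
    with w_ge_2 have "(cmod \<tau>)\<^sup>2 < cmod \<tau> ^ w"
      using expanding by (intro power_strict_increasing) auto
    with assms \<open>q = 2\<close> show False by (simp add: cmod_tau_sq)
  qed
qed

lemma naf_steps_not_contracting: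
  assumes y: "y \<in> Z_adjoin \<tau>" "\<not> Z_dvd \<tau> \<tau> y"
    and c: "c = (naf_step \<tau> w ^^ w) y" "cmod y \<le> cmod c"
  shows "q = 2" "\<tau>\<^sup>2 * c = 2 * y" "- c / 2 \<in> restricted_voronoi \<tau>"
proof -
  have "c \<in> Z_adjoin \<tau>" and y_eq: "y = next_digit \<tau> w y + \<tau> ^ w * c"
    using naf_steps_not_dvd[OF y] w_pos c(1) by (metis diff_self_eq_0 mult_1 order_refl power_0)+
  define v where "v = next_digit \<tau> w y / \<tau> ^ w"
  have vc: "y = \<tau> ^ w * (v + c)"
    using tau_nonzero by (subst y_eq) (simp add: v_def distrib_left)
  have "y \<noteq> 0" using y(2) by auto
  have "next_digit \<tau> w y \<noteq> 0"
    using Z_cong_imp_dvd_iff[OF next_digit_not_dvd(2)[OF y] w_pos] y(2) by auto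
  then have v: "v \<in> restricted_voronoi \<tau>"
    using next_digit_in_digits[OF y(1)] by (simp add: in_digits_iff v_def)
  then have "v \<in> voronoi \<tau>"
    using lattice.restricted_voronoi_subset by blast
  note bound = voronoi_remainder[OF this \<open>c \<in> Z_adjoin \<tau>\<close>]
  have cmod_y: "cmod y = cmod \<tau> ^ w * cmod (v + c)"
    by (subst vc) (simp add: norm_mult norm_power)
  have "v + c \<noteq> 0" using \<open>y \<noteq> 0\<close> vc by auto
  have "cmod \<tau> ^ w * cmod (v + c) \<le> 2 * cmod (v + c)"
    using bound(1) c(2) cmod_y by linarith
  then have "cmod \<tau> ^ w \<le> 2" using \<open>v + c \<noteq> 0\<close> by simp
  note q = cmod_tau_power_le_2(1)[OF this] and w = cmod_tau_power_le_2(2)[OF this]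
  show "q = 2" by (rule q)
  have "cmod c = 2 * cmod (v + c)"
    using bound(1) c(2) cmod_y by (simp add: w cmod_tau_sq q)
  then have "c = - 2 * v" by (rule bound(2))
  then show "\<tau>\<^sup>2 * c = 2 * y" "- c / 2 \<in> restricted_voronoi \<tau>"
    using v by (simp_all add: vc w)
qed

definition minimal_nonterminating :: "complex \<Rightarrow> bool" where
  "minimal_nonterminating y \<longleftrightarrow> y \<in> Z_adjoin \<tau> \<and> \<not> naf_terminates \<tau> w y \<and>
     (\<forall>x\<in>Z_adjoin \<tau>. \<not> naf_terminates \<tau> w x \<longrightarrow> cmod y \<le> cmod x)"

lemma minimal_nonterminating_nonzero: "minimal_nonterminating y \<Longrightarrow> y \<noteq> 0"
  unfolding minimal_nonterminating_def naf_terminates_def by (metis funpow_0)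

lemma minimal_nonterminating_not_dvd:
  assumes "minimal_nonterminating y"
  shows "\<not> Z_dvd \<tau> \<tau> y"
proof
  assume "Z_dvd \<tau> \<tau> y"
  then obtain x where x: "x \<in> Z_adjoin \<tau>" "y = \<tau> * x" by (auto simp: Z_dvd_def)
  then have "cmod x < cmod y"
    using minimal_nonterminating_nonzero[OF assms] expanding by (simp add: norm_mult)
  then have "naf_terminates \<tau> w x"
    using assms x(1) by (auto simp: minimal_nonterminating_def not_le[symmetric])
  then have "naf_terminates \<tau> w y"
    using naf_terminates_steps[of \<tau> w 1 y] x by (simp add: naf_step_mult)
  with assms show False by (simp add: minimal_nonterminating_def)
qed

lemma minimal_nonterminating_steps:
  assumes y: "minimal_nonterminating y" and c: "c = (naf_step \<tau> w ^^ w) y"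
  shows "minimal_nonterminating c" "q = 2" "\<tau>\<^sup>2 * c = 2 * y" "- c / 2 \<in> restricted_voronoi \<tau>"
proof -
  have "y \<in> Z_adjoin \<tau>" and c_nonterm: "c \<in> Z_adjoin \<tau>" "\<not> naf_terminates \<tau> w c"
    using y naf_steps_in_Z_adjoin naf_terminates_steps by (auto simp: minimal_nonterminating_def c)
  moreover have "cmod y \<le> cmod c"
    using y c_nonterm by (simp add: minimal_nonterminating_def)
  ultimately show q: "q = 2" and eq: "\<tau>\<^sup>2 * c = 2 * y" and "- c / 2 \<in> restricted_voronoi \<tau>"
    using naf_steps_not_contracting[OF _ minimal_nonterminating_not_dvd[OF y] c] by auto
  have "cmod c = cmod y"
    using arg_cong[OF eq, of cmod] by (simp add: norm_mult norm_power cmod_tau_sq q)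
  then show "minimal_nonterminating c"
    using y c_nonterm by (simp add: minimal_nonterminating_def)
qed

text \<open>The iteration multiplies a minimal nonterminating point by \<open>2 / \<tau>\<^sup>2\<close> again and again, so
  both halves \<open>\<plusminus> y / 2\<close> of some lattice point \<open>y\<close> would lie in the restricted cell.\<close>

lemma no_minimal_nonterminating: "\<not> minimal_nonterminating y0"
proof
  assume y0: "minimal_nonterminating y0"
  define y1 where "y1 = (naf_step \<tau> w ^^ w) y0"
  define y2 where "y2 = (naf_step \<tau> w ^^ w) y1"
  define y3 where "y3 = (naf_step \<tau> w ^^ w) y2"
  note y1 = minimal_nonterminating_steps[OF y0 y1_def]
  note y2 = minimal_nonterminating_steps[OF y1(1) y2_def]
  note y3 = minimal_nonterminating_steps[OF y2(1) y3_def]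
  have in_Z: "y0 \<in> Z_adjoin \<tau>" "y1 \<in> Z_adjoin \<tau>"
    using y0 y1(1) by (simp_all add: minimal_nonterminating_def)
  have "\<tau>\<^sup>2 = - 2 \<or> (\<tau>\<^sup>2)\<^sup>2 = - 4"
    using y1(2) in_Z minimal_nonterminating_not_dvd[OF y0] y1(3)
    by (rule tau_power_if_twice_eq_tau_sq_mult)
  then have "y2 = - y1 \<or> y3 = - y1"
  proof
    assume "\<tau>\<^sup>2 = - 2"
    then show ?thesis using y2(3) by (simp add: minus_equation_iff)
  next
    assume "(\<tau>\<^sup>2)\<^sup>2 = - 4"
    moreover have "(\<tau>\<^sup>2)\<^sup>2 * y3 = 4 * y1"
      using y2(3) y3(3) by (simp add: power2_eq_square mult.assoc)
    ultimately show ?thesis by (simp add: minus_equation_iff)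
  qed
  then have "- y1 / 2 - (- y1) \<in> restricted_voronoi \<tau>"
    using y2(4) y3(4) by auto
  then have "- y1 = 0"
    using lattice.restricted_voronoi_unique[OF y1(4)] in_Z(2) by blast
  with minimal_nonterminating_nonzero[OF y1(1)] show False by simp
qed

lemma naf_terminates_in_Z_adjoin:
  assumes "z \<in> Z_adjoin \<tau>"
  shows "naf_terminates \<tau> w z"
proof (rule ccontr)
  assume nonterm: "\<not> naf_terminates \<tau> w z"
  define S where "S = {y \<in> Z_adjoin \<tau>. \<not> naf_terminates \<tau> w y}"
  have "closed S"
    by (rule closed_subset_Z_adjoin) (auto simp: S_def)
  moreover have "S \<noteq> {}"
    using assms nonterm by (auto simp: S_def)
  ultimately obtain y where "y \<in> S" "\<And>x. x \<in> S \<Longrightarrow> dist 0 y \<le> dist 0 x"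
    using distance_attains_inf[of S 0] by blast
  then have "minimal_nonterminating y"
    by (simp add: minimal_nonterminating_def S_def)
  with no_minimal_nonterminating show False by blast
qed

end

theorem theorem7p1:
  fixes p q :: int and \<tau> :: complex and w :: nat
  assumes "4 * q - p ^ 2 > 0"
    and "\<tau> ^ 2 - of_int p * \<tau> + of_int q = 0"
    and "cmod \<tau> > 1"
    and "w \<ge> 2"
  shows "(\<forall>z \<in> Z_adjoin \<tau>.
            \<exists>!\<xi>. \<xi> \<in> wNAF_fin0 w (digits \<tau> w) \<and> naf_value \<tau> \<xi> = z)
       \<and> wNADS \<tau> w (digits \<tau> w)
       \<and> (\<forall>z \<in> Z_adjoin \<tau>. \<exists>ds. naf_algorithm \<tau> w z = Some ds
            \<and> word_seq ds \<in> wNAF_fin0 w (digits \<tau> w) \<and> naf_value \<tau> (word_seq ds) = z)"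
proof -
  interpret imaginary_quadratic_naf p q \<tau> w
    using assms by unfold_locales
  have "\<exists>!\<xi>. \<xi> \<in> wNAF_fin0 w (digits \<tau> w) \<and> naf_value \<tau> \<xi> = z" if "z \<in> Z_adjoin \<tau>" for z
    using ex1_wNAF[OF that naf_terminates_in_Z_adjoin[OF that]] .
  moreover have "\<exists>ds. naf_algorithm \<tau> w z = Some ds \<and> word_seq ds \<in> wNAF_fin0 w (digits \<tau> w)
      \<and> naf_value \<tau> (word_seq ds) = z" if "z \<in> Z_adjoin \<tau>" for z
    using naf_algorithm_output naf_seq_in_wNAF_fin0 naf_value_naf_seq
      naf_terminates_in_Z_adjoin that by metis
  ultimately show ?thesis by (simp add: wNADS_def)
qed

end
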